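(* Let $F(t,x,u,v)$ be continuous on $\Omega=[0,T_0]\times D_{R_0}\times D_{\rho_0}\times D_{\rho_0}$ and holomorphic in $(x,u,v)\in D_{R_0}\times D_{\rho_0}\times D_{\rho_0}$ for each fixed $t$. Let $\mu(t)$ be a weight function on $(0,T_0]$ and suppose that, as $t\to+0$, $$\sup_{x\in D_{R_0}}|F(t,x,0,0)|=O(\mu(t)),\qquad \sup_{x\in D_{R_0}}\Bigl|\frac{\partial F}{\partial v}(t,x,0,0)\Bigr|=O(\mu(t)),$$ and that $\mathrm{Re}\,\lambda(0,0)<0$, where $\lambda(t,x)=\frac{\partial F}{\partial u}(t,x,0,0)$. Let $u_0(t,x)$ be the solution of $$t\frac{\partial u}{\partial t}=F\Bigl(t,x,u,\frac{\partial u}{\partial x}\Bigr)\qquad(\mathrm{E})$$ described in the context. Let $u(t,x)\in\mathscr{X}_1((0,T)\times D_R)$ be a solution of $(\mathrm{E})$ with $T>0$ and $R>0$. If $$\varlimsup_{\rho\to+0}\Bigl[\lim_{\sigma\to+0}\Bigl(\frac{1}{\rho^2}\sup_{(0,\sigma)\times D_\rho}|u(t,x)|\Bigr)\Bigr]=0,$$ then $u(t,x)=u_0(t,x)$ on $(0,T_1)\times D_{R_1}$ for some $T_1>0$ and $R_1>0$.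
   Context: Here $t\in\mathbb{R}$ and $x,u,v\in\mathbb{C}$; $D_r=\{z\in\mathbb{C}: |z|<r\}$; $T_0,R_0,\rho_0>0$ are given. A weight function on $(0,T_0]$ is a positive-valued continuous function $\mu$ on $(0,T_0]$, increasing in $t$, with $\int_0^{T_0}\frac{\mu(s)}{s}ds<\infty$. $\mathscr{X}_1((0,T)\times D_R)$ is the set of functions in $C^1((0,T)\times D_R)$ that are holomorphic in $x\in D_R$ for each fixed $t$. A solution $u\in\mathscr{X}_1((0,T)\times D_R)$ of $(\mathrm{E})$ is understood to be such that $(t,x,u(t,x),\partial u/\partial x(t,x))\in\Omega$ and $(\mathrm{E})$ holds at all points of $(0,T)\times D_R$. Set $\varphi(t)=\int_0^t\frac{\mu(s)}{s}ds$ and $W_{T,R,r}=\{(t,x)\in[0,T]\times\mathbb{C}: \varphi(t)/r+|x|<R\}$. For $W=W_{T,R,r}$, $\mathscr{X}_1(W)$ is the set of functions in $C^1(W\cap\{t>0\})\cap C^0(W)$ that are holomorphic in $x$ for each fixed $t$. The solution $u_0$: it is known (Lope-Roque-Tahara) that under the stated hypotheses on $F$ (including $\mathrm{Re}\,\lambda(0,0)<0$) there are $T^*>0$, $R^*>0$, $r^*>0$ such that $(\mathrm{E})$ has a unique solution $u_0\in\mathscr{X}_1(W_{T^*,R^*,r^*})$ satisfying $|u_0(t,x)|\le M\mu(t)$ and $|\frac{\partial u_0}{\partial x}(t,x)|\le M\mu(t)$ on $W_{T^*,R^*,r^*}$ for some $M>0$. Fix such $T^*,R^*,r^*$ and this $u_0$.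 *)

theory Defs
  imports "HOL-Complex_Analysis.Complex_Analysis"
begin

definition weight_function :: "real \<Rightarrow> (real \<Rightarrow> real) \<Rightarrow> bool" where
  "weight_function T0 \<mu> \<longleftrightarrow>
     (\<forall>t\<in>{0<..T0}. 0 < \<mu> t) \<and> continuous_on {0<..T0} \<mu> \<and> mono_on {0<..T0} \<mu> \<and>
     set_integrable lborel {0<..T0} (\<lambda>s. \<mu> s / s)"

definition weight_phi :: "(real \<Rightarrow> real) \<Rightarrow> real \<Rightarrow> real" where
  "weight_phi \<mu> t = (LBINT s:{0<..t}. \<mu> s / s)"

definition W_region :: "(real \<Rightarrow> real) \<Rightarrow> real \<Rightarrow> real \<Rightarrow> real \<Rightarrow> (real \<times> complex) set" where
  "W_region \<mu> T R r = {(t, x). t \<in> {0..T} \<and> weight_phi \<mu> t / r + norm x < R}"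

definition Omega :: "real \<Rightarrow> real \<Rightarrow> real \<Rightarrow> (real \<times> complex \<times> complex \<times> complex) set" where
  "Omega T0 R0 \<rho>0 = {0..T0} \<times> ball 0 R0 \<times> ball 0 \<rho>0 \<times> ball 0 \<rho>0"

text \<open>Joint holomorphy in three variables, i.e. complex Frechet differentiability.\<close>

definition holomorphic3_on ::
    "(complex \<times> complex \<times> complex \<Rightarrow> complex) \<Rightarrow> (complex \<times> complex \<times> complex) set \<Rightarrow> bool" where
  "holomorphic3_on f S \<longleftrightarrow>
     (\<forall>p\<in>S. \<exists>a b c. (f has_derivative (\<lambda>(h, k, l). a * h + b * k + c * l)) (at p))"

text \<open>The derivative is taken within \<open>S\<close>: the regions \<open>W_region\<close> may contain points of their
  top boundary \<open>t = T\<close>, where only one-sided derivatives in \<open>t\<close> make sense.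
  For open \<open>S\<close> this is the usual class of C^1 functions in the real sense.\<close>

definition C1_on :: "('a::real_normed_vector) set \<Rightarrow> ('a \<Rightarrow> 'b::real_normed_vector) \<Rightarrow> bool" where
  "C1_on S f \<longleftrightarrow>
     (\<exists>f'. (\<forall>p\<in>S. (f has_derivative blinfun_apply (f' p)) (at p within S)) \<and> continuous_on S f')"

text \<open>If \<open>S\<close> lies in \<open>t > 0\<close>, as for the cylinder \<open>(0,T) \<times> D_R\<close>, the continuity clause is
  implied by the first one.\<close>

definition X1 :: "(real \<times> complex) set \<Rightarrow> (real \<times> complex \<Rightarrow> complex) \<Rightarrow> bool" where
  "X1 S u \<longleftrightarrow>
     C1_on (S \<inter> {p. 0 < fst p}) u \<and> continuous_on S u \<and>
     (\<forall>t. (\<lambda>x. u (t, x)) holomorphic_on {x. (t, x) \<in> S})"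

definition dx :: "(real \<times> complex \<Rightarrow> complex) \<Rightarrow> real \<Rightarrow> complex \<Rightarrow> complex" where
  "dx u t x = deriv (\<lambda>y. u (t, y)) x"

definition dt_within ::
    "(real \<times> complex) set \<Rightarrow> (real \<times> complex \<Rightarrow> complex) \<Rightarrow> real \<Rightarrow> complex \<Rightarrow> complex" where
  "dt_within S u t x = vector_derivative (\<lambda>s. u (s, x)) (at t within {s. 0 < s \<and> (s, x) \<in> S})"

definition solves_E ::
    "(real \<times> complex \<times> complex \<times> complex \<Rightarrow> complex) \<Rightarrow> real \<Rightarrow> real \<Rightarrow> real \<Rightarrow>
     (real \<times> complex) set \<Rightarrow> (real \<times> complex \<Rightarrow> complex) \<Rightarrow> bool" where
  "solves_E F T0 R0 \<rho>0 S u \<longleftrightarrow>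
     (\<forall>(t, x)\<in>S. 0 < t \<longrightarrow>
        (t, x, u (t, x), dx u t x) \<in> Omega T0 R0 \<rho>0 \<and>
        of_real t * dt_within S u t x = F (t, x, u (t, x), dx u t x))"

text \<open>Since \<open>\<mu>\<close> is defined for \<open>t > 0\<close> only, the bounds are imposed there; as \<open>\<mu>\<close> tends to 0,
  they force \<open>u (0, x) = 0\<close> by continuity.\<close>

definition bounded_solution_W ::
    "(real \<times> complex \<times> complex \<times> complex \<Rightarrow> complex) \<Rightarrow> real \<Rightarrow> real \<Rightarrow> real \<Rightarrow> (real \<Rightarrow> real) \<Rightarrow>
     (real \<times> complex) set \<Rightarrow> (real \<times> complex \<Rightarrow> complex) \<Rightarrow> bool" where
  "bounded_solution_W F T0 R0 \<rho>0 \<mu> W u \<longleftrightarrow>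
     X1 W u \<and> solves_E F T0 R0 \<rho>0 W u \<and>
     (\<exists>M>0. \<forall>(t, x)\<in>W. 0 < t \<longrightarrow> norm (u (t, x)) \<le> M * \<mu> t \<and> norm (dx u t x) \<le> M * \<mu> t)"

text \<open>Suprema are taken in \<open>ereal\<close>, since they may be infinite.\<close>

definition sup_bigO_at_0 :: "complex set \<Rightarrow> (real \<Rightarrow> complex \<Rightarrow> complex) \<Rightarrow> (real \<Rightarrow> real) \<Rightarrow> bool" where
  "sup_bigO_at_0 D g \<mu> \<longleftrightarrow>
     (\<exists>C. \<forall>\<^sub>F t in at_right 0. (SUP x\<in>D. ereal (norm (g t x))) \<le> ereal (C * \<mu> t))"

end

theory Submission
  imports Defs
begin

text \<open>The difference \<open>w = u - u\<^sub>0\<close> satisfies \<open>t w\<^sub>t = \<Lambda> w + B w\<^sub>x\<close>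
  with \<open>Re \<Lambda> < -c < 0\<close> and, by Cauchy's estimates, \<open>|B| \<le> C \<mu>(t) + K |w\<^sub>x|\<close>.
  Backwards in \<open>ln t\<close>, the characteristics therefore move at speed at most \<open>C \<mu> + 2 K M / \<delta>\<close>
  at distance \<open>\<delta>\<close> from the boundary of a region \<open>|x| + C \<phi>(t) < r\<close> where \<open>|w| \<le> M\<close>;
  they stay inside for a logarithmic time of order \<open>\<delta>\<^sup>2 / (K M)\<close>, during which \<open>w\<close> is damped:
  \<open>|w| \<le> M exp(-c \<delta>\<^sup>2 / (4 K M))\<close> on the region with \<open>r\<close> replaced by \<open>r - 2 \<delta>\<close>.
  The hypothesis \<open>|u| = o(\<rho>\<^sup>2)\<close> makes \<open>M / \<delta>\<^sup>2\<close> small at the start. The gain is then large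
  enough to iterate with shrinking \<open>\<delta>\<close>, and \<open>w\<close> vanishes on the limit region.\<close>

subsection \<open>Weight functions and the smallness condition\<close>

lemma weight_phi_split:
  assumes "weight_function T0 \<mu>" "0 < a" "a \<le> t" "t \<le> T0"
  shows "weight_phi \<mu> t = weight_phi \<mu> a + (LBINT s:{a<..t}. \<mu> s / s)"
proof -
  have int: "set_integrable lborel {0<..T0} (\<lambda>s. \<mu> s / s)"
    using assms(1) by (simp add: weight_function_def)
  have "{0<..t} = {0<..a} \<union> {a<..t}" using assms by auto
  moreover have "set_integrable lborel {0<..a} (\<lambda>s. \<mu> s / s)"
    by (rule set_integrable_subset[OF int]) (use assms in auto)
  moreover have "set_integrable lborel {a<..t} (\<lambda>s. \<mu> s / s)"
    by (rule set_integrable_subset[OF int]) (use assms in auto)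
  ultimately show ?thesis
    unfolding weight_phi_def using set_integral_Un[of "{0<..a}" "{a<..t}" lborel "\<lambda>s. \<mu> s / s"]
    by (metis disjoint_iff greaterThanAtMost_iff not_le)
qed

text \<open>The integrand may be singular at 0, so the integral is split at \<open>t/2\<close>. On
  \<open>{t/2..T0}\<close> it is continuous and the fundamental theorem of calculus applies;
  \<open>t < T0\<close> makes the derivative two-sided.\<close>

lemma has_real_derivative_weight_phi:
  assumes w: "weight_function T0 \<mu>" and t: "0 < t" "t < T0"
  shows "(weight_phi \<mu> has_real_derivative \<mu> t / t) (at t)"
proof -
  have "continuous_on {t/2..T0} \<mu>"
    using w t by (auto simp: weight_function_def intro: continuous_on_subset[of "{0<..T0}" \<mu>])
  then have "continuous_on {t/2..T0} (\<lambda>s. \<mu> s / s)"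
    using t by (intro continuous_intros) auto
  then have "((\<lambda>u. LBINT s=t/2..u. \<mu> s / s) has_vector_derivative \<mu> t / t) (at t within {t/2..T0})"
    using t by (intro interval_integral_FTC2) auto
  then have "((\<lambda>u. LBINT s=t/2..u. \<mu> s / s) has_vector_derivative \<mu> t / t) (at t)"
    using t by (simp add: at_within_Icc_at)
  then have "((\<lambda>u. LBINT s=t/2..u. \<mu> s / s) has_real_derivative \<mu> t / t) (at t)"
    by (simp only: has_real_derivative_iff_has_vector_derivative)
  then have "((\<lambda>u. weight_phi \<mu> (t/2) + (LBINT s=t/2..u. \<mu> s / s)) has_real_derivative 0 + \<mu> t / t) (at t)"
    by (intro DERIV_add DERIV_const)
  then have "((\<lambda>u. weight_phi \<mu> (t/2) + (LBINT s=t/2..u. \<mu> s / s)) has_real_derivative \<mu> t / t) (at t)"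
    by simp
  then show ?thesis
  proof (rule has_field_derivative_transform_within_open[where S="{t/2<..<T0}"])
    fix u assume "u \<in> {t/2<..<T0}"
    then show "weight_phi \<mu> (t/2) + (LBINT s=t/2..u. \<mu> s / s) = weight_phi \<mu> u"
      using t weight_phi_split[OF w, of "t/2" u] interval_integral_Ioc[of "t/2" u "\<lambda>s. \<mu> s / s"]
      by simp
  qed (use t in auto)
qed

lemma weight_phi_nonneg:
  assumes "weight_function T0 \<mu>" "t \<le> T0"
  shows "0 \<le> weight_phi \<mu> t"
  unfolding weight_phi_def set_lebesgue_integral_def
proof (rule integral_nonneg_AE, rule AE_I2)
  fix s
  show "0 \<le> indicat_real {0<..t} s *\<^sub>R (\<mu> s / s)"
  proof (cases "s \<in> {0<..t}")
    case True
    then have "0 < \<mu> s" using assms by (auto simp: weight_function_def)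
    with True show ?thesis by auto
  qed auto
qed

text \<open>\<open>weight_phi \<mu> t\<close> is what the integrals over \<open>{t..T0}\<close>
  still miss of the finite integral over \<open>{0<..T0}\<close>, which they exhaust as t tends to
  0.\<close>

lemma weight_phi_tendsto_0:
  assumes w: "weight_function T0 \<mu>" and T0: "0 < T0"
  shows "(weight_phi \<mu> \<longlongrightarrow> 0) (at_right 0)"
proof -
  have int: "set_integrable lborel {0<..T0} (\<lambda>s. \<mu> s / s)"
    using w by (simp add: weight_function_def)
  have "((\<lambda>t. LBINT s:{t..T0}. \<mu> s / s) \<longlongrightarrow> (LBINT s:{0<..T0}. \<mu> s / s)) (at_right 0)"
    by (rule tendsto_set_lebesgue_integral_at_right[OF T0 _ int]) auto
  then have "((\<lambda>t. (LBINT s:{0<..T0}. \<mu> s / s) - (LBINT s:{t..T0}. \<mu> s / s)) \<longlongrightarrow>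
      (LBINT s:{0<..T0}. \<mu> s / s) - (LBINT s:{0<..T0}. \<mu> s / s)) (at_right 0)"
    by (intro tendsto_intros)
  moreover have "\<forall>\<^sub>F t in at_right 0.
      (LBINT s:{0<..T0}. \<mu> s / s) - (LBINT s:{t..T0}. \<mu> s / s) = weight_phi \<mu> t"
    using eventually_at_right_real[OF T0]
  proof (rule eventually_mono)
    fix t assume t: "t \<in> {0<..<T0}"
    have "(LBINT s:{t..T0}. \<mu> s / s) = (LBINT s:{t<..T0}. \<mu> s / s)"
      by (rule set_integral_discrete_difference[where X="{t}"]) auto
    then show "(LBINT s:{0<..T0}. \<mu> s / s) - (LBINT s:{t..T0}. \<mu> s / s) = weight_phi \<mu> t"
      using weight_phi_split[OF w, of t T0] t by (simp add: weight_phi_def)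
  qed
  ultimately show ?thesis
    by (auto intro: Lim_transform_eventually)
qed

text \<open>A positive lower bound \<open>m\<close> on \<open>\<mu>\<close> would make \<open>\<phi>(t) - m ln t\<close> monotone.\<close>

lemma weight_function_tendsto_0:
  assumes w: "weight_function T0 \<mu>" and T0: "0 < T0"
  shows "(\<mu> \<longlongrightarrow> 0) (at_right 0)"
proof -
  have pos: "0 < \<mu> t" if "t \<in> {0<..T0}" for t using w that by (auto simp: weight_function_def)
  have mono: "\<mu> s \<le> \<mu> t" if "0 < s" "s \<le> t" "t \<le> T0" for s t
    using w that by (auto simp: weight_function_def mono_on_def)
  have small: "\<exists>t\<in>{0<..<T0}. \<mu> t < m" if "0 < m" for m
  proof (rule ccontr)
    assume "\<not> ?thesis"
    then have ge: "m \<le> \<mu> t" if "t \<in> {0<..<T0}" for t using that by force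
    define b where "b = T0 / 2"
    have b: "0 < b" "b < T0" using T0 by (auto simp: b_def)
    \<comment> \<open>Chosen so that \<open>m * (ln b - ln s) = weight_phi \<mu> b + 1\<close>;
      monotonicity then forces \<open>weight_phi \<mu> s \<le> -1\<close>, against its
      nonnegativity.\<close>
    define s where "s = b * exp (- (weight_phi \<mu> b + 1) / m)"
    have phib: "0 \<le> weight_phi \<mu> b" using weight_phi_nonneg[OF w] b by simp
    have s: "0 < s" "s \<le> b"
      using b phib \<open>0 < m\<close> by (auto simp: s_def mult_le_cancel_left2 divide_le_0_iff)
    have "weight_phi \<mu> s - m * ln s \<le> weight_phi \<mu> b - m * ln b"
    proof (rule DERIV_nonneg_imp_nondecreasing[OF \<open>s \<le> b\<close>])
      fix t assume t: "s \<le> t" "t \<le> b"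
      have "((\<lambda>t. weight_phi \<mu> t - m * ln t) has_real_derivative \<mu> t / t - m * (1 / t)) (at t)"
        using t s b by (intro DERIV_diff DERIV_cmult DERIV_ln_divide has_real_derivative_weight_phi[OF w]) auto
      moreover have "0 \<le> \<mu> t / t - m * (1 / t)"
        using ge[of t] t s b by (simp add: divide_right_mono)
      ultimately show "\<exists>y. ((\<lambda>t. weight_phi \<mu> t - m * ln t) has_real_derivative y) (at t) \<and> 0 \<le> y"
        by blast
    qed
    moreover have "m * ln s = m * ln b - (weight_phi \<mu> b + 1)"
      using b \<open>0 < m\<close> by (simp add: s_def ln_mult diff_divide_distrib add_divide_distrib ring_distribs)
    moreover have "0 \<le> weight_phi \<mu> s" using weight_phi_nonneg[OF w] b s by simp
    ultimately show False by simp
  qed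
  show ?thesis
  proof (rule order_tendstoI)
    fix a :: real assume "a < 0"
    have "\<forall>\<^sub>F t in at_right 0. t \<in> {0<..<T0}" using T0 by (rule eventually_at_right_real)
    then show "\<forall>\<^sub>F t in at_right 0. a < \<mu> t"
    proof (rule eventually_mono)
      fix t assume "t \<in> {0<..<T0}"
      then show "a < \<mu> t" using pos[of t] \<open>a < 0\<close> by simp
    qed
  next
    fix a :: real assume "0 < a"
    then obtain b where b: "b \<in> {0<..<T0}" "\<mu> b < a" using small by blast
    have "\<forall>\<^sub>F t in at_right 0. t \<in> {0<..<b}" using b by (intro eventually_at_right_real) auto
    then show "\<forall>\<^sub>F t in at_right 0. \<mu> t < a"
    proof (rule eventually_mono)
      fix t assume "t \<in> {0<..<b}"
      then show "\<mu> t < a" using mono[of t b] b by simp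
    qed
  qed
qed

section \<open>The iterated limit as an eventual bound\<close>

lemma mono_ereal_tendsto_Lim_at_right:
  fixes f :: "real \<Rightarrow> ereal"
  assumes "\<And>s t. 0 < s \<Longrightarrow> s \<le> t \<Longrightarrow> f s \<le> f t"
  shows "(f \<longlongrightarrow> Lim (at_right 0) f) (at_right 0)"
proof -
  \<comment> \<open>\<open>Lim\<close> is a definite description, so its value means something only
    once convergence is known. For a monotone function the limit is the infimum over positive
    arguments.\<close>
  have "(f \<longlongrightarrow> (INF s\<in>{0<..}. f s)) (at_right 0)"
  proof (rule order_tendstoI)
    fix a assume a: "a < (INF s\<in>{0<..}. f s)"
    show "\<forall>\<^sub>F s in at_right 0. a < f s"
      using eventually_at_right_less[of 0]
    proof (rule eventually_mono)
      fix s :: real assume "0 < s"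
      then have "(INF s\<in>{0<..}. f s) \<le> f s" by (intro INF_lower) simp
      with a show "a < f s" by (rule less_le_trans)
    qed
  next
    fix a assume "(INF s\<in>{0<..}. f s) < a"
    then obtain b where b: "0 < b" "f b < a" by (auto simp: INF_less_iff)
    have "\<forall>\<^sub>F t in at_right 0. t \<in> {0<..<b}" using b by (intro eventually_at_right_real)
    then show "\<forall>\<^sub>F t in at_right 0. f t < a"
    proof (rule eventually_mono)
      fix t assume "t \<in> {0<..<b}"
      then have "f t \<le> f b" by (intro assms) auto
      then show "f t < a" using b(2) by (rule le_less_trans)
    qed
  qed
  moreover from this have "Lim (at_right 0) f = (INF s\<in>{0<..}. f s)"
    by (intro tendsto_Lim) auto
  ultimately show ?thesis by simp
qed

text \<open>A limsup below \<epsilon> puts the inner limit below \<epsilon> for all small \<rho>.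
  The supremum grows with \<sigma>, so the inner limit is a true limit and the expression itself is
  below \<epsilon> for all small \<sigma>.\<close>

lemma eventually_small_of_Limsup_Lim:
  fixes u :: "real \<times> complex \<Rightarrow> complex"
  assumes lim: "Limsup (at_right 0) (\<lambda>\<rho>. Lim (at_right 0) (\<lambda>\<sigma>.
           ereal (1 / \<rho>\<^sup>2) * (SUP p\<in>{0<..<\<sigma>} \<times> ball 0 \<rho>. ereal (norm (u p))))) = 0"
    and e: "0 < \<epsilon>"
  shows "\<forall>\<^sub>F \<rho> in at_right 0. \<forall>\<^sub>F \<sigma> in at_right 0.
           \<forall>p\<in>{0<..<\<sigma>} \<times> ball 0 \<rho>. norm (u p) \<le> \<epsilon> * \<rho>\<^sup>2"
proof -
  let ?f = "\<lambda>\<rho> \<sigma>. ereal (1 / \<rho>\<^sup>2) * (SUP p\<in>{0<..<\<sigma>} \<times> ball 0 \<rho>. ereal (norm (u p)))"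
  have "\<forall>\<^sub>F \<rho> in at_right 0. Lim (at_right 0) (?f \<rho>) < ereal \<epsilon>"
    using lim e by (intro Limsup_lessD) simp
  moreover have "\<forall>\<^sub>F \<rho> in at_right 0. (0::real) < \<rho>" by (rule eventually_at_right_less)
  ultimately show ?thesis
  proof eventually_elim
    case (elim \<rho>)
    have "(?f \<rho> \<longlongrightarrow> Lim (at_right 0) (?f \<rho>)) (at_right 0)"
    proof (rule mono_ereal_tendsto_Lim_at_right)
      fix s t :: real assume "0 < s" "s \<le> t"
      then show "?f \<rho> s \<le> ?f \<rho> t"
        by (intro ereal_mult_left_mono SUP_subset_mono) auto
    qed
    then have "\<forall>\<^sub>F \<sigma> in at_right 0. ?f \<rho> \<sigma> < ereal \<epsilon>"
      using elim(1) by (rule order_tendstoD(2))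
    then show ?case
    proof (rule eventually_mono, intro ballI)
      fix \<sigma> :: real and p :: "real \<times> complex" assume less: "?f \<rho> \<sigma> < ereal \<epsilon>" and p: "p \<in> {0<..<\<sigma>} \<times> ball 0 \<rho>"
      have "ereal (1 / \<rho>\<^sup>2) * ereal (norm (u p)) \<le> ?f \<rho> \<sigma>"
        using p by (intro ereal_mult_left_mono SUP_upper) auto
      also note less
      finally have "norm (u p) / \<rho>\<^sup>2 < \<epsilon>" by simp
      then show "norm (u p) \<le> \<epsilon> * \<rho>\<^sup>2"
        using elim(2) by (simp add: divide_less_eq)
    qed
  qed
qed

subsection \<open>Linearization by Cauchy estimates\<close>

lemma norm_deriv_le:
  assumes "f holomorphic_on S" "cball z q \<subseteq> S" "0 < q" "\<And>y. y \<in> cball z q \<Longrightarrow> norm (f y) \<le> A"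
  shows "norm (deriv f z) \<le> A / q"
proof -
  have "norm ((deriv ^^ 1) f z) \<le> fact 1 * A / q ^ 1"
  proof (rule Cauchy_inequality)
    show "f holomorphic_on ball z q"
      using assms(1,2) ball_subset_cball by (blast intro: holomorphic_on_subset)
    show "continuous_on (cball z q) f"
      using assms(1,2) by (blast intro: holomorphic_on_subset holomorphic_on_imp_continuous_on)
  qed (use assms in \<open>auto simp: dist_norm\<close>)
  then show ?thesis by simp
qed

lemma norm_diff_le_deriv:
  fixes f :: "complex \<Rightarrow> complex"
  assumes "f holomorphic_on S" "open S" "convex C" "C \<subseteq> S" "\<And>z. z \<in> C \<Longrightarrow> norm (deriv f z) \<le> B"
    "a \<in> C" "b \<in> C"
  shows "norm (f a - f b) \<le> B * norm (a - b)"
proof (rule field_differentiable_bound[OF assms(3) _ assms(5) assms(6,7)])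
  fix z assume "z \<in> C"
  then have "(f has_field_derivative deriv f z) (at z)"
    using assms(1,2,4) by (auto intro: holomorphic_derivI)
  then show "(f has_field_derivative deriv f z) (at z within C)"
    by (rule has_field_derivative_at_within)
qed

text \<open>Cauchy's estimate on discs of radius q turns a bound on the larger ball into a Lipschitz
  constant on the smaller one.\<close>

lemma norm_diff_le_ball:
  fixes f :: "complex \<Rightarrow> complex"
  assumes f: "f holomorphic_on ball 0 r" and q: "0 < q" "s + q < r"
    and A: "\<And>z. z \<in> cball 0 (s + q) \<Longrightarrow> norm (f z) \<le> A"
    and ab: "a \<in> cball 0 s" "b \<in> cball 0 s"
  shows "norm (f a - f b) \<le> A / q * norm (a - b)"
proof (rule norm_diff_le_deriv[OF f open_ball convex_cball _ _ ab])
  show "cball 0 s \<subseteq> ball 0 r" using q by auto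
  fix z :: complex assume "z \<in> cball 0 s"
  then have sub: "cball z q \<subseteq> cball 0 (s + q)" by (auto simp: cball_subset_cball_iff)
  show "norm (deriv f z) \<le> A / q"
  proof (rule norm_deriv_le[OF f _ q(1)])
    show "cball z q \<subseteq> ball 0 r" using sub q by fastforce
  qed (use sub A in auto)
qed

text \<open>Cauchy's estimate for \<open>f (a + z) - g z\<close> at \<open>z = 0\<close>: uniform
  closeness of two functions gives closeness of their derivatives, even at different base
  points.\<close>

lemma norm_deriv_diff_le:
  assumes f: "f holomorphic_on ball 0 r" and g: "g holomorphic_on ball 0 r"
    and q: "norm a + q < r" "0 < q"
    and e: "\<And>z. norm z \<le> q \<Longrightarrow> norm (f (a + z) - g z) \<le> e"
  shows "norm (deriv f a - deriv g 0) \<le> e / q"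
proof -
  have "(f has_field_derivative deriv f a) (at (0 + a))"
    using holomorphic_derivI[OF f, of a] q by simp
  then have "((\<lambda>z. f (z + a)) has_field_derivative deriv f a) (at 0)"
    by (subst (asm) DERIV_shift)
  moreover have "(g has_field_derivative deriv g 0) (at 0)"
    using holomorphic_derivI[OF g, of 0] q le_less_trans[OF norm_ge_zero[of a], of r] by simp
  ultimately have "deriv (\<lambda>z. f (z + a) - g z) 0 = deriv f a - deriv g 0"
    by (intro DERIV_imp_deriv derivative_intros)
  moreover have "norm (deriv (\<lambda>z. f (z + a) - g z) 0) \<le> e / q"
  proof (rule norm_deriv_le[where S="ball 0 (r - norm a)"])
    have "f \<circ> (\<lambda>z. z + a) holomorphic_on ball 0 (r - norm a)"
    proof (rule holomorphic_on_compose_gen[OF _ f])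
      show "(\<lambda>z. z + a) ` ball 0 (r - norm a) \<subseteq> ball 0 r"
      proof (rule image_subsetI)
        fix z :: complex assume "z \<in> ball 0 (r - norm a)"
        then show "z + a \<in> ball 0 r" using norm_triangle_ineq[of z a] by simp
      qed
    qed (intro holomorphic_intros)
    moreover have "g holomorphic_on ball 0 (r - norm a)"
      using subset_ball[of "r - norm a" r 0] by (intro holomorphic_on_subset[OF g]) auto
    ultimately show "(\<lambda>z. f (z + a) - g z) holomorphic_on ball 0 (r - norm a)"
      by (auto intro!: holomorphic_intros simp: o_def)
  qed (use q e in \<open>auto simp: add.commute\<close>)
  ultimately show ?thesis by simp
qed

text \<open>The difference \<open>g(u, v + \<cdot>) - g(0, \<cdot>)\<close> is bounded by a multiple of \<open>|u| + |v|\<close>,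
  so Cauchy's estimate bounds its derivative without recourse to second derivatives of \<open>g\<close>.\<close>

lemma deriv_snd_diff_le:
  fixes g :: "complex \<Rightarrow> complex \<Rightarrow> complex"
  assumes hu: "\<And>v. v \<in> ball 0 r \<Longrightarrow> (\<lambda>u. g u v) holomorphic_on ball 0 r"
    and hv: "\<And>u. u \<in> ball 0 r \<Longrightarrow> (\<lambda>v. g u v) holomorphic_on ball 0 r"
    and q: "0 < q" "3 * q < r"
    and A: "\<And>u v. u \<in> cball 0 (3 * q) \<Longrightarrow> v \<in> cball 0 (3 * q) \<Longrightarrow> norm (g u v) \<le> A"
    and uv: "u \<in> cball 0 q" "v \<in> cball 0 q"
  shows "norm (deriv (g u) v - deriv (g 0) 0) \<le> A / q\<^sup>2 * (norm u + norm v)"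
proof -
  have "norm (deriv (g u) v - deriv (g 0) 0) \<le> A / q * (norm u + norm v) / q"
  proof (rule norm_deriv_diff_le)
    fix z :: complex assume z: "norm z \<le> q"
    \<comment> \<open>All points lie within radius \<open>2 * q\<close>, so discs of radius q around
      them stay in the ball of radius \<open>3 * q\<close> where A is a bound.\<close>
    have vz: "norm (v + z) \<le> 2 * q" using norm_triangle_ineq[of v z] uv z by simp
    have "norm (g u (v + z) - g 0 (v + z)) \<le> A / q * norm (u - 0)"
      by (rule norm_diff_le_ball[where s="2*q" and r=r]) (use hu q A uv vz in auto)
    moreover have "norm (g 0 (v + z) - g 0 z) \<le> A / q * norm (v + z - z)"
      by (rule norm_diff_le_ball[where s="2*q" and r=r]) (use hv q A uv vz z in auto)
    ultimately show "norm (g u (v + z) - g 0 z) \<le> A / q * (norm u + norm v)"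
      using norm_triangle_ineq[of "g u (v + z) - g 0 (v + z)" "g 0 (v + z) - g 0 z"]
      by (simp add: algebra_simps)
  qed (use hv[of u] hv[of 0] uv q in auto)
  then show ?thesis by (simp add: power2_eq_square)
qed

section \<open>From joint holomorphy to a linear form of the increments of F\<close>

lemma holomorphic3_on_imp_sections:
  assumes "holomorphic3_on f (ball 0 R \<times> ball 0 r \<times> ball 0 r)" "x \<in> ball 0 R"
  shows "v \<in> ball 0 r \<Longrightarrow> (\<lambda>u. f (x, u, v)) holomorphic_on ball 0 r"
    and "u \<in> ball 0 r \<Longrightarrow> (\<lambda>v. f (x, u, v)) holomorphic_on ball 0 r"
proof -
  \<comment> \<open>Both sections at once: p is the embedding that moves either u or v. The chain
    rule leaves a complex multiple of the increment, hence complex differentiability.\<close>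
  have diff: "(\<lambda>z. f (x, p z)) field_differentiable (at w)"
    if p: "p = (\<lambda>z. (z, v)) \<and> u = w \<or> p = (\<lambda>z. (u, z)) \<and> v = w" and uv: "u \<in> ball 0 r" "v \<in> ball 0 r" for p u v w
  proof -
    have pw: "(x, p w) = (x, u, v)" using p by auto
    obtain a b c where "(f has_derivative (\<lambda>(h, k, l). a * h + b * k + c * l)) (at (x, p w))"
      using assms uv pw unfolding holomorphic3_on_def by (metis mem_Sigma_iff)
    moreover have "((\<lambda>z. (z, v)) has_derivative (\<lambda>h. (h, 0))) (at w)"
      "((\<lambda>z. (u, z)) has_derivative (\<lambda>h. (0, h))) (at w)"
      by (auto intro!: derivative_eq_intros)
    then obtain p' where "p' = (\<lambda>h. (h, 0)) \<or> p' = (\<lambda>h. (0, h))" "(p has_derivative p') (at w)"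
      using p by blast
    ultimately have "((\<lambda>z. f (x, p z)) has_derivative (\<lambda>h. case (0, p' h) of (h, k, l) \<Rightarrow> a * h + b * k + c * l)) (at w)"
      by (intro has_derivative_compose[of "\<lambda>z. (x, p z)" "\<lambda>h. (0, p' h)" w UNIV f])
        (auto intro!: derivative_eq_intros)
    then have "\<exists>d. ((\<lambda>z. f (x, p z)) has_field_derivative d) (at w)"
      using \<open>p' = _ \<or> _\<close> by (auto simp: has_field_derivative_def)
    then show ?thesis by (auto simp: field_differentiable_def)
  qed
  show "(\<lambda>u. f (x, u, v)) holomorphic_on ball 0 r" if "v \<in> ball 0 r"
    using diff[of "\<lambda>z. (z, v)" v, OF disjI1, OF conjI] that by (auto simp: holomorphic_on_open field_differentiable_def)
  show "(\<lambda>v. f (x, u, v)) holomorphic_on ball 0 r" if "u \<in> ball 0 r"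
    using diff[of "\<lambda>z. (u, z)" _ u, OF disjI2, OF conjI] that by (auto simp: holomorphic_on_open field_differentiable_def)
qed

text \<open>The factor is the quotient \<open>a / d\<close>; if \<open>d = 0\<close> the bound
  forces \<open>a = 0\<close> and l itself serves. This yields coefficients \<Lambda> and B
  pointwise, without averaging derivatives along a segment.\<close>

lemma ex_factor:
  fixes a d l :: complex
  assumes "norm (a - l * d) \<le> e * norm d" "0 \<le> e"
  obtains m where "a = m * d" "norm (m - l) \<le> e"
proof (cases "d = 0")
  case True
  then show ?thesis using assms that[of l] by simp
next
  case False
  then have "a / d - l = (a - l * d) / d" by (simp add: field_simps)
  then have "norm (a / d - l) \<le> e"
    using assms False by (simp add: norm_divide divide_le_eq)
  then show ?thesis using that[of "a / d"] False by simp
qed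

lemma dist_quad_le:
  fixes x x' u u' v v' :: complex and t t' :: real
  shows "dist (t, x, u, v) (t', x', u', v') \<le> \<bar>t - t'\<bar> + norm (x - x') + norm (u - u') + norm (v - v')"
proof -
  have *: "dist (a, b) (a', b') \<le> dist a a' + dist b b'" for a a' :: "'x::metric_space" and b b' :: "'y::metric_space"
    unfolding dist_Pair_Pair by (rule sqrt_sum_squares_le_sum) auto
  show ?thesis
    using *[of t "(x, u, v)" t' "(x', u', v')"] *[of x "(u, v)" x' "(u', v')"] *[of u v u' v']
    by (simp add: dist_norm)
qed

lemma sup_bigO_at_0D:
  assumes "sup_bigO_at_0 D g \<mu>"
  obtains C where "\<forall>\<^sub>F t in at_right 0. \<forall>x\<in>D. norm (g t x) \<le> C * \<mu> t"
proof -
  obtain C where C: "\<forall>\<^sub>F t in at_right 0. (SUP x\<in>D. ereal (norm (g t x))) \<le> ereal (C * \<mu> t)"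
    using assms by (auto simp: sup_bigO_at_0_def)
  have "\<forall>\<^sub>F t in at_right 0. \<forall>x\<in>D. norm (g t x) \<le> C * \<mu> t"
    using C by (rule eventually_mono) (auto simp: SUP_le_iff)
  then show ?thesis by (rule that)
qed

text \<open>The increment is split at \<open>(t, x, u', v)\<close>. The u-derivative stays near its
  value at the origin, which controls \<open>Re \<Lambda>\<close>. The v-derivative at u' differs
  from its O(\<mu>) value at \<open>u = v = 0\<close> by a multiple of the arguments. Splitting
  there leaves u' but not u in the bound for B, so that later only the known solution enters
  undifferentiated.\<close>

lemma linearization:
  fixes F :: "real \<times> complex \<times> complex \<times> complex \<Rightarrow> complex"
  assumes pos: "0 < T0" "0 < R0" "0 < \<rho>0"
    and cont: "continuous_on (Omega T0 R0 \<rho>0) F"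
    and hol: "\<And>t. t \<in> {0..T0} \<Longrightarrow>
           holomorphic3_on (\<lambda>(x, u, v). F (t, x, u, v)) (ball 0 R0 \<times> ball 0 \<rho>0 \<times> ball 0 \<rho>0)"
    and \<mu>: "\<And>t. t \<in> {0<..T0} \<Longrightarrow> 0 < \<mu> t"
    and Fv: "sup_bigO_at_0 (ball 0 R0) (\<lambda>t x. deriv (\<lambda>v. F (t, x, 0, v)) 0) \<mu>"
    and c: "Re (deriv (\<lambda>u. F (0, 0, u, 0)) 0) < - c"
  obtains r C K where "0 < r" "0 \<le> C" "0 < K"
    "\<And>t x u v u' v'. \<lbrakk>0 < t; t < r; norm x < r; norm u < r; norm v < r; norm u' < r; norm v' < r\<rbrakk> \<Longrightarrow>
       \<exists>\<Lambda> B. F (t, x, u, v) - F (t, x, u', v') = \<Lambda> * (u - u') + B * (v - v') \<and>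
         Re \<Lambda> < - c \<and> norm B \<le> C * \<mu> t + K * (norm u' + norm v + norm v')"
proof -
  define l where "l = deriv (\<lambda>u. F (0, 0, u, 0)) 0"
  define q where "q = \<rho>0 / 4"
  have q: "0 < q" "3 * q < \<rho>0" using pos by (auto simp: q_def)
  \<comment> \<open>Half the gap between \<open>Re l\<close> and \<open>- c\<close>: a factor within
    e of l still has real part below \<open>- c\<close>.\<close>
  define e where "e = (- c - Re l) / 2"
  have e: "0 < e" using c by (simp add: e_def l_def)
  \<comment> \<open>Compactness gives both a bound A and uniform continuity of F; the radius
    \<open>3 * q\<close> is the room that \<open>deriv_snd_diff_le\<close> asks for.\<close>
  define box where "box = {0..T0} \<times> cball (0::complex) (R0 / 2) \<times> cball (0::complex) (3 * q) \<times> cball (0::complex) (3 * q)"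
  have box: "compact box" "box \<subseteq> Omega T0 R0 \<rho>0"
    using pos q by (auto simp: box_def Omega_def intro!: compact_Times)
  have contb: "continuous_on box F" using cont box(2) by (rule continuous_on_subset)
  obtain A where A: "0 < A" "\<And>p. p \<in> box \<Longrightarrow> norm (F p) \<le> A"
    using compact_imp_bounded[OF compact_continuous_image[OF contb box(1)]]
    unfolding bounded_pos by auto
  have "uniformly_continuous_on box F" using contb box(1) by (rule compact_uniformly_continuous)
  then obtain d where d: "0 < d"
    "\<And>p p'. p \<in> box \<Longrightarrow> p' \<in> box \<Longrightarrow> dist p p' < d \<Longrightarrow> dist (F p) (F p') < e * q"
    using e q unfolding uniformly_continuous_on_def by (metis mult_pos_pos)
  obtain C0 where "\<forall>\<^sub>F t in at_right 0. \<forall>x\<in>ball 0 R0. norm (deriv (\<lambda>v. F (t, x, 0, v)) 0) \<le> C0 * \<mu> t"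
    using Fv by (rule sup_bigO_at_0D)
  then obtain b where b: "0 < b" "\<And>t x. 0 < t \<Longrightarrow> t < b \<Longrightarrow> norm x < R0 \<Longrightarrow>
      norm (deriv (\<lambda>v. F (t, x, 0, v)) 0) \<le> C0 * \<mu> t"
    unfolding eventually_at_right_field by auto
  \<comment> \<open>With \<open>d / 4\<close>, four coordinate differences below r add up to less
    than d. The other entries keep the shifted arguments in the box and t in the range of the
    O(\<mu>) bound.\<close>
  define r where "r = Min {b, T0, R0 / 2, q, d / 4}"
  have r: "0 < r" "r \<le> b" "r \<le> T0" "r \<le> R0 / 2" "r \<le> q" "r \<le> d / 4"
    using b d pos q by (auto simp: r_def)
  have sec: "v \<in> ball 0 \<rho>0 \<Longrightarrow> (\<lambda>u. F (t, x, u, v)) holomorphic_on ball 0 \<rho>0"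
    "u \<in> ball 0 \<rho>0 \<Longrightarrow> (\<lambda>v. F (t, x, u, v)) holomorphic_on ball 0 \<rho>0"
    if "0 \<le> t" "t < r" "norm x < r" for t x u v
    using holomorphic3_on_imp_sections[OF hol[of t], of x] that r pos by auto
  have Fu: "norm (deriv (\<lambda>u. F (t, x, u, v)) u - l) \<le> e"
    if *: "0 < t" "t < r" "norm x < r" "norm u < r" "norm v < r" for t x u v
  proof -
    have "norm (deriv (\<lambda>u. F (t, x, u, v)) u - deriv (\<lambda>u. F (0, 0, u, 0)) 0) \<le> e * q / q"
    proof (rule norm_deriv_diff_le)
      show "(\<lambda>u. F (t, x, u, v)) holomorphic_on ball 0 \<rho>0" "(\<lambda>u. F (0, 0, u, 0)) holomorphic_on ball 0 \<rho>0"
        using sec(1) * q r by auto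
      fix z :: complex assume z: "norm z \<le> q"
      have "(t, x, u + z, v) \<in> box" "(0, 0, z, 0) \<in> box"
        using * z r q pos norm_triangle_ineq[of u z] by (auto simp: box_def)
      moreover have "dist (t, x, u + z, v) (0, 0, z, 0) < d"
        using dist_quad_le[of t x "u + z" v 0 0 z 0] * r by simp
      ultimately show "norm (F (t, x, u + z, v) - F (0, 0, z, 0)) \<le> e * q"
        using d(2) by (fastforce simp: dist_norm)
    qed (use * r q in auto)
    then show ?thesis using q by (simp add: l_def)
  qed
  show ?thesis
  proof (rule that)
    show "0 < r" "0 \<le> \<bar>C0\<bar>" "0 < A / q\<^sup>2" using r A q by auto
    fix t :: real and x u v u' v' :: complex
    assume *: "0 < t" "t < r" "norm x < r" "norm u < r" "norm v < r" "norm u' < r" "norm v' < r"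
    \<comment> \<open>Subtracting \<open>l * w\<close> leaves a function with derivative at most e,
      so its increments compare the increment of F in u with \<open>l * (u - u')\<close>.\<close>
    let ?f = "\<lambda>w. F (t, x, w, v) - l * w"
    have hf: "(\<lambda>w. F (t, x, w, v)) holomorphic_on ball 0 \<rho>0"
      and hg: "(\<lambda>w. F (t, x, u', w)) holomorphic_on ball 0 \<rho>0"
      using sec[of t x] * q r by auto
    have "norm (?f u - ?f u') \<le> e * norm (u - u')"
    proof (rule norm_diff_le_deriv[where C="ball 0 r" and S="ball 0 \<rho>0"])
      show "?f holomorphic_on ball 0 \<rho>0" using hf by (intro holomorphic_intros)
      fix w :: complex assume w: "w \<in> ball 0 r"
      have "((\<lambda>w. F (t, x, w, v)) has_field_derivative deriv (\<lambda>w. F (t, x, w, v)) w) (at w)"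
        using w r q by (intro holomorphic_derivI[OF hf]) auto
      then have "(?f has_field_derivative deriv (\<lambda>w. F (t, x, w, v)) w - l * 1) (at w)"
        by (intro DERIV_diff DERIV_cmult DERIV_ident)
      then have "deriv ?f w = deriv (\<lambda>w. F (t, x, w, v)) w - l"
        by (simp add: DERIV_imp_deriv)
      then show "norm (deriv ?f w) \<le> e" using Fu[of t x w v] * w by simp
    qed (use * r q in auto)
    then obtain \<Lambda> where \<Lambda>: "F (t, x, u, v) - F (t, x, u', v) = \<Lambda> * (u - u')" "norm (\<Lambda> - l) \<le> e"
      using ex_factor[of "F (t, x, u, v) - F (t, x, u', v)" l "u - u'" e] e
      by (auto simp: algebra_simps)
    have "Re \<Lambda> < - c"
      using abs_Re_le_cmod[of "\<Lambda> - l"] \<Lambda>(2) e by (simp add: e_def)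
    define E where "E = \<bar>C0\<bar> * \<mu> t + A / q\<^sup>2 * (norm u' + norm v + norm v')"
    have \<mu>t: "0 < \<mu> t" using \<mu>[of t] * r by simp
    have "norm (F (t, x, u', v) - F (t, x, u', v')) \<le> E * norm (v - v')"
    proof (rule norm_diff_le_deriv[where C="closed_segment v v'", OF hg])
      have sub: "closed_segment v v' \<subseteq> ball 0 r"
        using * by (intro closed_segment_subset) auto
      then show "closed_segment v v' \<subseteq> ball 0 \<rho>0" using r q by fastforce
      fix w assume w: "w \<in> closed_segment v v'"
      \<comment> \<open>On the segment the norm never exceeds that of the larger endpoint; this
        brings \<open>norm v + norm v'\<close> into the bound for B.\<close>
      have "w \<in> cball 0 (max (norm v) (norm v'))"
        using w closed_segment_subset[of v "cball 0 (max (norm v) (norm v'))" v'] by auto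
      then have w': "norm w \<le> norm v + norm v'"
        by (auto simp: max_def intro: add_increasing add_increasing2 split: if_splits)
      have "norm w < r" using sub w by auto
      have "norm (deriv (\<lambda>w. F (t, x, u', w)) w - deriv (\<lambda>w. F (t, x, 0, w)) 0) \<le>
          A / q\<^sup>2 * (norm u' + norm w)"
      proof (rule deriv_snd_diff_le[where g="\<lambda>u v. F (t, x, u, v)" and r=\<rho>0])
        fix a b :: complex assume "a \<in> cball 0 (3 * q)" "b \<in> cball 0 (3 * q)"
        then have "(t, x, a, b) \<in> box" using * r by (auto simp: box_def)
        then show "norm (F (t, x, a, b)) \<le> A" by (rule A(2))
      qed (use sec[of t x] * q r \<open>norm w < r\<close> in auto)
      also have "\<dots> \<le> A / q\<^sup>2 * (norm u' + norm v + norm v')"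
        using w' A(1) by (intro mult_left_mono) auto
      finally have "norm (deriv (\<lambda>w. F (t, x, u', w)) w) \<le>
          norm (deriv (\<lambda>w. F (t, x, 0, w)) 0) + A / q\<^sup>2 * (norm u' + norm v + norm v')"
        using norm_triangle_sub[of "deriv (\<lambda>w. F (t, x, u', w)) w" "deriv (\<lambda>w. F (t, x, 0, w)) 0"] by simp
      moreover have "norm (deriv (\<lambda>w. F (t, x, 0, w)) 0) \<le> C0 * \<mu> t"
        using b(2)[of t x] * r by simp
      moreover have "C0 * \<mu> t \<le> \<bar>C0\<bar> * \<mu> t" using \<mu>t by (intro mult_right_mono) auto
      ultimately show "norm (deriv (\<lambda>w. F (t, x, u', w)) w) \<le> E" by (simp add: E_def)
    qed auto
    moreover have "0 \<le> E" using \<mu>t A(1) by (simp add: E_def)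
    ultimately obtain B where B: "F (t, x, u', v) - F (t, x, u', v') = B * (v - v')" "norm B \<le> E"
      using ex_factor[of "F (t, x, u', v) - F (t, x, u', v')" 0 "v - v'" E] by auto
    have "F (t, x, u, v) - F (t, x, u', v') = \<Lambda> * (u - u') + B * (v - v')"
      using \<Lambda>(1) B(1) by (simp add: algebra_simps)
    then show "\<exists>\<Lambda> B. F (t, x, u, v) - F (t, x, u', v') = \<Lambda> * (u - u') + B * (v - v') \<and>
         Re \<Lambda> < - c \<and> norm B \<le> \<bar>C0\<bar> * \<mu> t + A / q\<^sup>2 * (norm u' + norm v + norm v')"
      using \<open>Re \<Lambda> < - c\<close> B(2) unfolding E_def by blast
  qed
qed

subsection \<open>Damping along characteristics\<close>

text \<open>A maximum principle for \<open>t\<^sup>2\<^sup>c |w|\<^sup>2\<close> on the region \<open>|x| + \<psi>(t) + L ln t \<le> k\<close>: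
  moving backwards in time along \<open>(-t, B)\<close> one stays inside the region, while this quantity
  strictly increases as long as \<open>w \<noteq> 0\<close>. So its maximum is attained at the earliest time.\<close>

lemma transport_max_principle:
  fixes w :: "real \<times> complex \<Rightarrow> complex" and a b :: "real \<Rightarrow> complex \<Rightarrow> complex"
  assumes s: "0 < s" "s \<le> t1" and L: "0 \<le> L"
    and Q: "Q = {(t, x). s \<le> t \<and> t \<le> t1 \<and> norm x + \<psi> t + L * ln t \<le> k}"
    and psi_deriv: "\<And>t. t \<in> {s..t1} \<Longrightarrow> (\<psi> has_real_derivative m t / t) (at t)"
    and psi_nonneg: "\<And>t. t \<in> {s..t1} \<Longrightarrow> 0 \<le> \<psi> t"
    and w_deriv: "\<And>t x. (t, x) \<in> Q \<Longrightarrow>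
      (w has_derivative (\<lambda>(\<tau>, h). of_real \<tau> * a t x + b t x * h)) (at (t, x))"
    and eq: "\<And>t x. (t, x) \<in> Q \<Longrightarrow>
      \<exists>\<Lambda> B. of_real t * a t x = \<Lambda> * w (t, x) + B * b t x \<and> Re \<Lambda> < - c \<and> norm B < m t + L"
    and bound: "\<And>x. (s, x) \<in> Q \<Longrightarrow> norm (w (s, x)) \<le> M"
    and p1: "(t1, x1) \<in> Q" and M: "0 \<le> M"
  shows "norm (w (t1, x1)) \<le> exp (- c * ln (t1 / s)) * M"
proof (cases "w (t1, x1) = 0")
  case True
  then show ?thesis using M by simp
next
  case False
  define G where "G = (\<lambda>(t, x). exp (2 * c * ln t) * (norm (w (t, x)))\<^sup>2)"
  let ?g = "\<lambda>p. norm (snd p) + \<psi> (fst p) + L * ln (fst p)"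
  let ?box = "{s..t1} \<times> cball (0::complex) (k - L * ln s)"
  have "continuous_on {s..t1} \<psi>"
    using psi_deriv by (meson DERIV_isCont continuous_at_imp_continuous_on)
  then have "continuous_on ?box (\<lambda>p. \<psi> (fst p))"
    by (rule continuous_on_compose2) (auto intro!: continuous_intros)
  then have "continuous_on ?box ?g"
    using s by (intro continuous_intros) auto
  then have "closed {p \<in> ?box. ?g p \<le> k}"
    by (intro continuous_on_closed_Collect_le continuous_on_const closed_Times) auto
  moreover have "Q = {p \<in> ?box. ?g p \<le> k}"
  proof -
    have "norm x \<le> k - L * ln s" if "(t, x) \<in> Q" for t x
    proof -
      have "L * ln s \<le> L * ln t" using that s L by (auto simp: Q intro!: mult_left_mono)
      then show ?thesis using that psi_nonneg[of t] by (auto simp: Q)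
    qed
    then show ?thesis by (auto simp: Q)
  qed
  moreover have "bounded ?box"
    by (intro bounded_Times bounded_cball bounded_closed_interval)
  then have "bounded {p \<in> ?box. ?g p \<le> k}" by (rule bounded_subset) blast
  ultimately have "compact Q" by (simp only: compact_eq_bounded_closed)
  moreover have "continuous_on Q w"
    using w_deriv by (auto intro!: continuous_at_imp_continuous_on has_derivative_continuous)
  then have "continuous_on Q G"
    unfolding G_def case_prod_unfold using s
    by (intro continuous_intros) (auto simp: Q case_prod_unfold)
  ultimately obtain p where "p \<in> Q" "\<And>p'. p' \<in> Q \<Longrightarrow> G p' \<le> G p"
    using continuous_attains_sup[of Q G] p1 by blast
  then obtain t x where tx: "(t, x) \<in> Q" and max: "\<And>p'. p' \<in> Q \<Longrightarrow> G p' \<le> G (t, x)"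
    by (cases p) auto
  have t: "s \<le> t" "t \<le> t1" "0 < t" using tx s by (auto simp: Q)
  have "0 < G (t1, x1)" using False by (simp add: G_def)
  then have "0 < G (t, x)" using max[OF p1] by linarith
  then have w0: "0 < norm (w (t, x))" by (auto simp: G_def)
  have "t = s"
  proof (rule ccontr)
    assume "t \<noteq> s"
    then have "s < t" using t by simp
    obtain \<Lambda> B where \<Lambda>: "of_real t * a t x = \<Lambda> * w (t, x) + B * b t x" "Re \<Lambda> < - c" "norm B < m t + L"
      using eq[OF tx] by blast
    \<comment> \<open>The backward characteristic direction at the maximum point, with B frozen
      there. Along it the \<open>b t x\<close> terms cancel and w has derivative
      \<open>- \<Lambda> * w (t, x)\<close>.\<close>
    define \<gamma> where "\<gamma> = (\<lambda>h. (t - h * t, x + of_real h * B))"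
    have "(\<gamma> has_derivative (\<lambda>h. (- (h * t), of_real h * B))) (at 0)"
      unfolding \<gamma>_def by (auto intro!: derivative_eq_intros)
    moreover have "(w has_derivative (\<lambda>(\<tau>, h). of_real \<tau> * a t x + b t x * h)) (at (\<gamma> 0))"
      using w_deriv[OF tx] by (simp add: \<gamma>_def)
    ultimately have "((\<lambda>h. w (\<gamma> h)) has_derivative
        (\<lambda>h. case (- (h * t), of_real h * B) of (\<tau>, h) \<Rightarrow> of_real \<tau> * a t x + b t x * h)) (at 0)"
      by (rule has_derivative_compose)
    moreover have "(case (- (h * t), of_real h * B) of (\<tau>, h) \<Rightarrow> of_real \<tau> * a t x + b t x * h)
        = h *\<^sub>R (- \<Lambda> * w (t, x))" for h
    proof -
      have "of_real (- (h * t)) * a t x + b t x * (of_real h * B)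
          = of_real h * (b t x * B - of_real t * a t x)" by (simp add: algebra_simps)
      then show ?thesis using \<Lambda>(1) by (simp add: scaleR_conv_of_real)
    qed
    ultimately have wh: "((\<lambda>h. w (\<gamma> h)) has_derivative (\<lambda>h. h *\<^sub>R (- \<Lambda> * w (t, x)))) (at 0)"
      by simp
    have \<gamma>0: "w (\<gamma> 0) = w (t, x)" by (simp add: \<gamma>_def)
    have "((\<lambda>h. w (\<gamma> h) \<bullet> w (\<gamma> h)) has_derivative
        (\<lambda>h. w (\<gamma> 0) \<bullet> (h *\<^sub>R (- \<Lambda> * w (t, x))) + (h *\<^sub>R (- \<Lambda> * w (t, x))) \<bullet> w (\<gamma> 0))) (at 0)"
      using wh wh by (rule has_derivative_inner)
    moreover have "w (t, x) \<bullet> (\<Lambda> * w (t, x)) = Re \<Lambda> * (norm (w (t, x)))\<^sup>2"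
      by (simp add: inner_complex_def cmod_power2) (simp add: algebra_simps power2_eq_square)
    ultimately have "((\<lambda>h. w (\<gamma> h) \<bullet> w (\<gamma> h)) has_derivative (*) (- 2 * Re \<Lambda> * (norm (w (t, x)))\<^sup>2)) (at 0)"
      by (elim has_derivative_eq_rhs) (simp add: fun_eq_iff \<gamma>0 inner_commute[of "\<Lambda> * w (t, x)"])
    then have "((\<lambda>h. (norm (w (\<gamma> h)))\<^sup>2) has_real_derivative - 2 * Re \<Lambda> * (norm (w (t, x)))\<^sup>2) (at 0)"
      by (simp only: has_field_derivative_def power2_norm_eq_inner)
    moreover have ln_deriv: "((\<lambda>h. ln (t - h * t)) has_real_derivative - 1) (at 0)"
      using t by (auto intro!: derivative_eq_intros)
    then have "((\<lambda>h. exp (2 * c * ln (t - h * t))) has_real_derivative exp (2 * c * ln (t - 0 * t)) * (2 * c * (- 1))) (at 0)"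
      by (intro DERIV_fun_exp DERIV_cmult)
    ultimately have "((\<lambda>h. exp (2 * c * ln (t - h * t)) * (norm (w (\<gamma> h)))\<^sup>2) has_real_derivative
        exp (2 * c * ln (t - 0 * t)) * (2 * c * (- 1)) * (norm (w (\<gamma> 0)))\<^sup>2
        + (- 2 * Re \<Lambda> * (norm (w (t, x)))\<^sup>2) * exp (2 * c * ln (t - 0 * t))) (at 0)"
      by (intro DERIV_mult)
    then have "((\<lambda>h. G (\<gamma> h)) has_real_derivative
        exp (2 * c * ln t) * (norm (w (t, x)))\<^sup>2 * (2 * (- c - Re \<Lambda>))) (at 0)"
      by (simp add: G_def \<gamma>_def algebra_simps)
    moreover have "0 < exp (2 * c * ln t) * (norm (w (t, x)))\<^sup>2 * (2 * (- c - Re \<Lambda>))"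
      using w0 \<Lambda>(2) by simp
    ultimately obtain d1 where d1: "0 < d1" "\<And>h. 0 < h \<Longrightarrow> h < d1 \<Longrightarrow> G (\<gamma> 0) < G (\<gamma> (0 + h))"
      using DERIV_pos_inc_right by blast
    have "((\<lambda>h. t - h * t) has_real_derivative - t) (at 0)"
      by (auto intro!: derivative_eq_intros)
    moreover have "(\<psi> has_real_derivative m t / t) (at (t - 0 * t))"
      using psi_deriv[of t] t by simp
    ultimately have "((\<lambda>h. \<psi> (t - h * t)) has_real_derivative m t / t * - t) (at 0)"
      by (rule DERIV_chain2[rotated])
    \<comment> \<open>\<open>norm x + h * norm B\<close> is a differentiable majorant of the norm of
      \<open>x + h * B\<close>. The slope \<open>norm B - m t - L\<close> is negative, so the curve
      stays in Q.\<close>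
    then have "((\<lambda>h. norm x + h * norm B + \<psi> (t - h * t) + L * ln (t - h * t)) has_real_derivative
        (0 + 1 * norm B) + m t / t * - t + L * (- 1)) (at 0)"
      by (intro DERIV_add DERIV_const DERIV_cmult DERIV_cmult_right DERIV_ident ln_deriv)
    moreover have "(0 + 1 * norm B) + m t / t * - t + L * (- 1) < 0" using \<Lambda>(3) t by simp
    ultimately obtain d2 where d2: "0 < d2" "\<And>h. 0 < h \<Longrightarrow> h < d2 \<Longrightarrow>
        norm x + 0 * norm B + \<psi> (t - 0 * t) + L * ln (t - 0 * t) >
        norm x + (0 + h) * norm B + \<psi> (t - (0 + h) * t) + L * ln (t - (0 + h) * t)"
      using DERIV_neg_dec_right by blast
    \<comment> \<open>The third entry keeps \<open>t - h * t\<close> above s.\<close>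
    have "0 < min d1 (min d2 ((t - s) / t))" using d1(1) d2(1) \<open>s < t\<close> t by simp
    then obtain h where h: "0 < h" "h < d1" "h < d2" "h < (t - s) / t"
      using dense by (metis min_less_iff_conj)
    have "h * t < t - s" using h t by (simp add: field_simps)
    moreover have "norm (x + of_real h * B) \<le> norm x + h * norm B"
      using norm_triangle_ineq[of x "of_real h * B"] h by (simp add: norm_mult)
    moreover have "t - h * t \<le> t1" using h t mult_nonneg_nonneg[of h t] by linarith
    ultimately have "\<gamma> h \<in> Q"
      using d2(2)[of h] h tx t by (auto simp: Q \<gamma>_def)
    then have "G (\<gamma> h) \<le> G (t, x)" by (rule max)
    moreover have "G (t, x) < G (\<gamma> h)" using d1(2)[of h] h by (simp add: \<gamma>_def)
    ultimately show False by simp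
  qed
  have "G (t1, x1) \<le> G (s, x)" using max[OF p1] \<open>t = s\<close> by simp
  also have "\<dots> \<le> exp (2 * c * ln s) * M\<^sup>2"
    using bound[of x] tx \<open>t = s\<close> by (simp add: G_def power_mono)
  finally have "exp (2 * c * ln t1) * (norm (w (t1, x1)))\<^sup>2 \<le> exp (2 * c * ln s) * M\<^sup>2"
    by (simp only: G_def case_prod_conv)
  then have "(exp (c * ln t1) * norm (w (t1, x1)))\<^sup>2 \<le> (exp (c * ln s) * M)\<^sup>2"
    unfolding mult.assoc[of 2 c] exp_double power_mult_distrib .
  then have "exp (c * ln t1) * norm (w (t1, x1)) \<le> exp (c * ln s) * M"
    by (rule power2_le_imp_le) (use M in simp)
  then have "norm (w (t1, x1)) \<le> exp (c * ln s) * M / exp (c * ln t1)"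
    by (simp add: pos_le_divide_eq mult.commute)
  also have "\<dots> = exp (c * ln s - c * ln t1) * M"
    by (simp only: exp_diff times_divide_eq_left)
  also have "c * ln s - c * ln t1 = - c * ln (t1 / s)"
    using s by (simp add: ln_div right_diff_distrib)
  finally show ?thesis .
qed

text \<open>At distance \<delta> from the boundary, Cauchy's estimate bounds
  \<open>K * norm (b t x)\<close> below L. Moving with extra speed L for the logarithmic time
  \<open>\<delta> / L\<close> costs radius \<delta>, while damping at rate c gains the factor
  \<open>exp (- c * \<delta> / L)\<close>. Of the loss \<open>2 * \<delta>\<close>, one \<delta>
  pays for the motion and the other for the Cauchy discs.\<close>

lemma descent_step:
  fixes w :: "real \<times> complex \<Rightarrow> complex" and a b :: "real \<Rightarrow> complex \<Rightarrow> complex"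
  assumes K: "0 < K" and M: "0 < M" and \<delta>: "0 < \<delta>" and r: "r \<le> \<rho>"
    and psi_deriv: "\<And>t. t \<in> {0<..<\<sigma>} \<Longrightarrow> (\<psi> has_real_derivative m t / t) (at t)"
    and psi_nonneg: "\<And>t. t \<in> {0<..<\<sigma>} \<Longrightarrow> 0 \<le> \<psi> t"
    and w_deriv: "\<And>t x. t \<in> {0<..<\<sigma>} \<Longrightarrow> x \<in> ball 0 \<rho> \<Longrightarrow>
      (w has_derivative (\<lambda>(\<tau>, h). of_real \<tau> * a t x + b t x * h)) (at (t, x))"
    and eq: "\<And>t x. t \<in> {0<..<\<sigma>} \<Longrightarrow> x \<in> ball 0 \<rho> \<Longrightarrow>
      \<exists>\<Lambda> B. of_real t * a t x = \<Lambda> * w (t, x) + B * b t x \<and> Re \<Lambda> < - c \<and>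
        norm B \<le> m t + K * norm (b t x)"
    and bound: "\<And>t x. t \<in> {0<..<\<sigma>} \<Longrightarrow> norm x + \<psi> t < r \<Longrightarrow> norm (w (t, x)) \<le> M"
    and t1: "t1 \<in> {0<..<\<sigma>}" and x1: "norm x1 + \<psi> t1 < r - 2 * \<delta>"
  shows "norm (w (t1, x1)) \<le> exp (- c * (\<delta>\<^sup>2 / (4 * K * M))) * M"
proof -
  \<comment> \<open>Twice the Cauchy bound \<open>2 * K * M / \<delta>\<close>, which makes the
    speed inequality strict.\<close>
  define L where "L = 4 * K * M / \<delta>"
  have L: "0 < L" using K M \<delta> by (simp add: L_def)
  define s where "s = t1 * exp (- \<delta> / L)"
  have s: "0 < s" "s \<le> t1" "s < \<sigma>" "ln t1 - ln s = \<delta> / L"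
    using t1 \<delta> L by (auto simp: s_def ln_mult mult_le_cancel_left2 intro: le_less_trans[of _ t1])
  have b_eq: "((\<lambda>x. w (t, x)) has_field_derivative b t x) (at x)"
    if "t \<in> {0<..<\<sigma>}" "x \<in> ball 0 \<rho>" for t x
  proof -
    have "((\<lambda>y. w (t, y)) has_derivative (\<lambda>h. case (0, h) of (\<tau>, h) \<Rightarrow> of_real \<tau> * a t x + b t x * h)) (at x)"
      by (rule has_derivative_compose[where f="Pair t" and f'="Pair 0", OF _ w_deriv[OF that]])
        (auto intro!: derivative_eq_intros)
    then show ?thesis by (simp add: has_field_derivative_def)
  qed
  \<comment> \<open>At time t1 the region Q has radius \<open>r - 2 * \<delta> - \<psi> t1\<close>;
    back to time s, the term \<open>L * ln t\<close> widens it by exactly \<delta>.\<close>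
  define k where "k = r - 2 * \<delta> + L * ln t1"
  define Q where "Q = {(t, x :: complex). s \<le> t \<and> t \<le> t1 \<and> norm x + \<psi> t + L * ln t \<le> k}"
  have Q: "t \<in> {0<..<\<sigma>} \<and> norm x + \<psi> t \<le> r - \<delta> \<and> x \<in> ball 0 \<rho>" if "(t, x) \<in> Q" for t x
  proof -
    have t: "s \<le> t" "t \<le> t1" "t \<in> {0<..<\<sigma>}" using that s t1 by (auto simp: Q_def)
    have "ln s \<le> ln t" using t s by simp
    then have "L * (ln t1 - ln t) \<le> L * (ln t1 - ln s)"
      using L by (intro mult_left_mono) simp_all
    also have "\<dots> = \<delta>" using s(4) L by simp
    finally have "norm x + \<psi> t \<le> r - \<delta>"
      using that by (simp add: Q_def k_def right_diff_distrib)
    then show ?thesis using psi_nonneg[OF t(3)] r \<delta> t(3) by auto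
  qed
  have "norm (w (t1, x1)) \<le> exp (- c * ln (t1 / s)) * M"
  proof (rule transport_max_principle[OF s(1,2) less_imp_le[OF L] Q_def])
    fix t x assume tx: "(t, x) \<in> Q"
    have \<psi>: "0 \<le> \<psi> t" using Q[OF tx] psi_nonneg by blast
    then show "(w has_derivative (\<lambda>(\<tau>, h). of_real \<tau> * a t x + b t x * h)) (at (t, x))"
      using Q[OF tx] w_deriv by blast
    have "norm (deriv (\<lambda>y. w (t, y)) x) \<le> M / (\<delta> / 2)"
    proof (rule norm_deriv_le[where S="ball 0 (r - \<psi> t)"])
      show "(\<lambda>y. w (t, y)) holomorphic_on ball 0 (r - \<psi> t)"
        unfolding holomorphic_on_open[OF open_ball]
      proof (intro ballI exI)
        fix y :: complex assume "y \<in> ball 0 (r - \<psi> t)"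
        then show "((\<lambda>y. w (t, y)) has_field_derivative b t y) (at y)"
          using Q[OF tx] r \<psi> by (intro b_eq) auto
      qed
      have "cball x (\<delta> / 2) \<subseteq> ball 0 (r - \<psi> t)"
        using Q[OF tx] \<delta> by (auto simp: cball_subset_ball_iff)
      then show "cball x (\<delta> / 2) \<subseteq> ball 0 (r - \<psi> t)"
        "\<And>y. y \<in> cball x (\<delta> / 2) \<Longrightarrow> norm (w (t, y)) \<le> M"
        using Q[OF tx] bound by (auto simp: less_diff_eq)
    qed (use \<delta> in auto)
    moreover have "deriv (\<lambda>y. w (t, y)) x = b t x"
      using Q[OF tx] b_eq by (blast intro: DERIV_imp_deriv)
    ultimately have "K * norm (b t x) \<le> K * (M / (\<delta> / 2))"
      using K by (intro mult_left_mono) auto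
    also have "\<dots> < L" using K M \<delta> by (simp add: L_def field_simps)
    finally show "\<exists>\<Lambda> B. of_real t * a t x = \<Lambda> * w (t, x) + B * b t x \<and> Re \<Lambda> < - c \<and> norm B < m t + L"
      using eq[of t x] Q[OF tx] by fastforce
  next
    fix x assume "(s, x) \<in> Q"
    then show "norm (w (s, x)) \<le> M" using Q[of s x] bound[of s x] \<delta> by simp
  next
    fix t assume "t \<in> {s..t1}"
    then have "t \<in> {0<..<\<sigma>}" using s t1 by auto
    then show "(\<psi> has_real_derivative m t / t) (at t)" "0 \<le> \<psi> t"
      using psi_deriv psi_nonneg by auto
  next
    show "(t1, x1) \<in> Q" using s x1 by (simp add: Q_def k_def)
  qed (use M in auto)
  also have "ln (t1 / s) = \<delta>\<^sup>2 / (4 * K * M)"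
    using s t1 by (simp add: ln_div L_def power2_eq_square)
  finally show ?thesis .
qed

text \<open>The shrinking widths \<open>\<delta>\<^sub>n = (\<rho>/8) 2\<^sup>-\<^sup>n\<close> and the bounds \<open>M 4\<^sup>-\<^sup>n\<close> keep \<open>\<delta>\<^sub>n\<^sup>2 / M\<^sub>n\<close> constant,
  so that each step gains the same factor.\<close>

lemma descent_eq_0:
  fixes w :: "real \<times> complex \<Rightarrow> complex" and a b :: "real \<Rightarrow> complex \<Rightarrow> complex"
  assumes K: "0 < K" and M: "0 < M" and \<rho>: "0 < \<rho>"
    and psi_deriv: "\<And>t. t \<in> {0<..<\<sigma>} \<Longrightarrow> (\<psi> has_real_derivative m t / t) (at t)"
    and psi_nonneg: "\<And>t. t \<in> {0<..<\<sigma>} \<Longrightarrow> 0 \<le> \<psi> t"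
    and w_deriv: "\<And>t x. t \<in> {0<..<\<sigma>} \<Longrightarrow> x \<in> ball 0 \<rho> \<Longrightarrow>
      (w has_derivative (\<lambda>(\<tau>, h). of_real \<tau> * a t x + b t x * h)) (at (t, x))"
    and eq: "\<And>t x. t \<in> {0<..<\<sigma>} \<Longrightarrow> x \<in> ball 0 \<rho> \<Longrightarrow>
      \<exists>\<Lambda> B. of_real t * a t x = \<Lambda> * w (t, x) + B * b t x \<and> Re \<Lambda> < - c \<and>
        norm B \<le> m t + K * norm (b t x)"
    and bound: "\<And>t x. t \<in> {0<..<\<sigma>} \<Longrightarrow> x \<in> ball 0 \<rho> \<Longrightarrow> norm (w (t, x)) \<le> M"
    and small: "ln 4 \<le> c * ((\<rho> / 8)\<^sup>2 / (4 * K * M))"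
    and t: "t \<in> {0<..<\<sigma>}" and x: "norm x + \<psi> t < \<rho> / 2"
  shows "w (t, x) = 0"
proof -
  have step: "\<forall>t\<in>{0<..<\<sigma>}. \<forall>x. norm x + \<psi> t < \<rho> / 2 + \<rho> / 2 / 2 ^ n \<longrightarrow> norm (w (t, x)) \<le> M / 4 ^ n" for n
  proof (induction n)
    case 0
    then show ?case using bound psi_nonneg by force
  next
    case (Suc n)
    let ?\<delta> = "\<rho> / 8 / 2 ^ n" and ?M = "M / 4 ^ n"
    show ?case
    proof (intro ballI allI impI)
      fix t :: real and x :: complex
      assume t: "t \<in> {0<..<\<sigma>}" and x: "norm x + \<psi> t < \<rho> / 2 + \<rho> / 2 / 2 ^ Suc n"
      have "\<rho> / 2 / 2 ^ n \<le> \<rho> / 2 / 1" using \<rho> by (intro divide_left_mono) auto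
      then have r: "\<rho> / 2 + \<rho> / 2 / 2 ^ n \<le> \<rho>" by simp
      have "norm (w (t, x)) \<le> exp (- c * (?\<delta>\<^sup>2 / (4 * K * ?M))) * ?M"
      proof (rule descent_step[OF K _ _ r psi_deriv psi_nonneg w_deriv eq])
        \<comment> \<open>The loss of two widths is exactly the drop from one radius to the
          next.\<close>
        have "\<rho> / 2 / 2 ^ Suc n = \<rho> / 2 / 2 ^ n - 2 * ?\<delta>" by (simp add: field_simps)
        then show "norm x + \<psi> t < \<rho> / 2 + \<rho> / 2 / 2 ^ n - 2 * ?\<delta>" using x by linarith
      qed (use M \<rho> Suc t in auto)
      also have "?\<delta>\<^sup>2 / (4 * K * ?M) = (\<rho> / 8)\<^sup>2 / (4 * K * M)"
      proof -
        have "(2 ^ n)\<^sup>2 = (4 ^ n :: real)" by (simp add: power_mult[symmetric] mult.commute[of n] power_mult)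
        then show ?thesis by (simp add: power_divide)
      qed
      \<comment> \<open>The hypothesis \<open>small\<close> makes the damping factor at most 1/4,
        the ratio of consecutive bounds.\<close>
      also have "exp (- c * ((\<rho> / 8)\<^sup>2 / (4 * K * M))) * ?M \<le> exp (- ln 4) * ?M"
        using small M by (intro mult_right_mono) simp_all
      also have "exp (- ln 4) * ?M = M / 4 ^ Suc n" by (simp add: exp_minus)
      finally show "norm (w (t, x)) \<le> M / 4 ^ Suc n" .
    qed
  qed
  have "norm (w (t, x)) \<le> M * (1 / 4) ^ n" for n
  proof -
    have "0 < \<rho> / 2 / 2 ^ n" using \<rho> by simp
    then have "norm x + \<psi> t < \<rho> / 2 + \<rho> / 2 / 2 ^ n" using x by linarith
    then show ?thesis using step[of n] t by (simp add: power_one_over)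
  qed
  moreover have "(\<lambda>n. M * (1 / 4) ^ n) \<longlonglongrightarrow> M * 0"
    by (intro tendsto_intros LIMSEQ_realpow_zero) auto
  ultimately have "norm (w (t, x)) \<le> M * 0"
    by (intro LIMSEQ_le_const) auto
  then show ?thesis by simp
qed

section \<open>The total derivative of a function in \<open>X1\<close>\<close>

lemma X1_has_derivative:
  assumes X: "X1 S u" and sub: "{0<..<\<sigma>} \<times> ball 0 \<rho> \<subseteq> S" and t: "t \<in> {0<..<\<sigma>}" and x: "x \<in> ball 0 \<rho>"
  shows "(u has_derivative (\<lambda>(\<tau>, h). of_real \<tau> * dt_within S u t x + dx u t x * h)) (at (t, x))"
proof -
  let ?U = "{0<..<\<sigma>} \<times> ball (0::complex) \<rho>"
  have U: "open ?U" "(t, x) \<in> ?U" "?U \<subseteq> S \<inter> {p. 0 < fst p}"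
    using sub t x by (auto intro: open_Times)
  obtain f' where "\<forall>p\<in>S \<inter> {p. 0 < fst p}. (u has_derivative blinfun_apply (f' p)) (at p within S \<inter> {p. 0 < fst p})"
    using X by (auto simp: X1_def C1_on_def)
  then have "(u has_derivative blinfun_apply (f' (t, x))) (at (t, x) within ?U)"
    using U by (blast intro: has_derivative_subset)
  then have D: "(u has_derivative blinfun_apply (f' (t, x))) (at (t, x))"
    using U by (simp add: at_within_open[of _ ?U])
  define D where "D = blinfun_apply (f' (t, x))"
  \<comment> \<open>D is so far only real linear; this separates its time part from its space
    part.\<close>
  have lin: "D (\<tau>, h) = of_real \<tau> * D (1, 0) + D (0, h)" for \<tau> h
  proof -
    have "D (\<tau>, h) = D (\<tau> *\<^sub>R (1, 0) + (0, h))" by simp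
    also have "\<dots> = \<tau> *\<^sub>R D (1, 0) + D (0, h)"
      unfolding D_def blinfun.add_right blinfun.scaleR_right ..
    finally show ?thesis by (simp add: scaleR_conv_of_real)
  qed
  have "((\<lambda>s. u (s, x)) has_derivative (\<lambda>\<tau>. D (\<tau>, 0))) (at t)"
    unfolding D_def
    by (rule has_derivative_compose[where f="\<lambda>s. (s, x)" and f'="\<lambda>\<tau>. (\<tau>, 0)", OF _ D])
      (auto intro!: derivative_eq_intros)
  moreover have "(\<lambda>\<tau>. D (\<tau>, 0)) = (\<lambda>\<tau>. \<tau> *\<^sub>R D (1, 0))"
  proof
    fix \<tau>
    have "D (0, 0) = 0" unfolding D_def zero_prod_def[symmetric] by (rule blinfun.zero_right)
    then show "D (\<tau>, 0) = \<tau> *\<^sub>R D (1, 0)"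
      unfolding lin[of \<tau> 0] by (simp only: scaleR_conv_of_real add_0_right)
  qed
  ultimately have "((\<lambda>s. u (s, x)) has_vector_derivative D (1, 0)) (at t)"
    by (simp only: has_vector_derivative_def)
  then have "vector_derivative (\<lambda>s. u (s, x)) (at t) = D (1, 0)"
    by (rule vector_derivative_at)
  \<comment> \<open>At an interior time the derivative within the slice of S is the ordinary
    one.\<close>
  moreover have "t \<in> interior {s. 0 < s \<and> (s, x) \<in> S}"
    by (rule interiorI[of "{0<..<\<sigma>}"]) (use sub t x in auto)
  then have "at t within {s. 0 < s \<and> (s, x) \<in> S} = at t"
    by (rule at_within_interior)
  ultimately have dt: "dt_within S u t x = D (1, 0)"
    by (simp only: dt_within_def)
  \<comment> \<open>Holomorphy in x makes multiplication by \<open>dx u t x\<close> a derivative of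
    the slice; uniqueness identifies it with the space part of D.\<close>
  have "(\<lambda>y. u (t, y)) holomorphic_on {y. (t, y) \<in> S}" using X by (simp add: X1_def)
  then have "(\<lambda>y. u (t, y)) holomorphic_on ball 0 \<rho>"
    by (rule holomorphic_on_subset) (use sub t in auto)
  then have "((\<lambda>y. u (t, y)) has_derivative (*) (dx u t x)) (at x)"
    using x unfolding dx_def by (auto dest: holomorphic_derivI simp: has_field_derivative_def)
  moreover have "((\<lambda>y. u (t, y)) has_derivative (\<lambda>h. D (0, h))) (at x)"
    unfolding D_def
    by (rule has_derivative_compose[where f="Pair t" and f'="Pair 0", OF _ D])
      (auto intro!: derivative_eq_intros)
  ultimately have "(*) (dx u t x) = (\<lambda>h. D (0, h))" by (rule has_derivative_unique)
  then have dx: "D (0, h) = dx u t x * h" for h by (rule fun_cong[symmetric])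
  have "D = (\<lambda>(\<tau>, h). of_real \<tau> * dt_within S u t x + dx u t x * h)"
  proof
    fix p :: "real \<times> complex"
    obtain \<tau> h where "p = (\<tau>, h)" by (cases p)
    then show "D p = (case p of (\<tau>, h) \<Rightarrow> of_real \<tau> * dt_within S u t x + dx u t x * h)"
      using lin[of \<tau> h] by (simp only: case_prod_conv dt dx)
  qed
  then show ?thesis using D by (simp add: D_def)
qed

subsection \<open>Uniqueness\<close>

theorem theorem2p2:
  fixes F :: "real \<times> complex \<times> complex \<times> complex \<Rightarrow> complex"
    and \<mu> :: "real \<Rightarrow> real"
    and T0 R0 \<rho>0 Ts Rs rs T R :: real
    and u0 u :: "real \<times> complex \<Rightarrow> complex"
  assumes "0 < T0" and "0 < R0" and "0 < \<rho>0"
    and "continuous_on (Omega T0 R0 \<rho>0) F"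
    and "\<And>t. t \<in> {0..T0} \<Longrightarrow>
           holomorphic3_on (\<lambda>(x, u, v). F (t, x, u, v)) (ball 0 R0 \<times> ball 0 \<rho>0 \<times> ball 0 \<rho>0)"
    and "weight_function T0 \<mu>"
    and "sup_bigO_at_0 (ball 0 R0) (\<lambda>t x. F (t, x, 0, 0)) \<mu>"
    and "sup_bigO_at_0 (ball 0 R0) (\<lambda>t x. deriv (\<lambda>v. F (t, x, 0, v)) 0) \<mu>"
    and "Re (deriv (\<lambda>u. F (0, 0, u, 0)) 0) < 0"
    and "0 < Ts" and "Ts \<le> T0" and "0 < Rs" and "0 < rs"
    and "bounded_solution_W F T0 R0 \<rho>0 \<mu> (W_region \<mu> Ts Rs rs) u0"
    and "\<And>w. bounded_solution_W F T0 R0 \<rho>0 \<mu> (W_region \<mu> Ts Rs rs) w \<Longrightarrow>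
           \<forall>p\<in>W_region \<mu> Ts Rs rs. w p = u0 p"
    and "0 < T" and "0 < R"
    and "X1 ({0<..<T} \<times> ball 0 R) u"
    and "solves_E F T0 R0 \<rho>0 ({0<..<T} \<times> ball 0 R) u"
    and "Limsup (at_right 0) (\<lambda>\<rho>. Lim (at_right 0) (\<lambda>\<sigma>.
           ereal (1 / \<rho>\<^sup>2) * (SUP p\<in>{0<..<\<sigma>} \<times> ball 0 \<rho>. ereal (norm (u p))))) = 0"
  shows "\<exists>T1>0. \<exists>R1>0.
           {0<..<T1} \<times> ball 0 R1 \<subseteq> ({0<..<T} \<times> ball 0 R) \<inter> W_region \<mu> Ts Rs rs \<and>
           (\<forall>p\<in>{0<..<T1} \<times> ball 0 R1. u p = u0 p)"
proof -
  note pos = assms(1-3) and wt = assms(6) and sol0 = assms(14) and X = assms(18) and sol = assms(19)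
  let ?W = "W_region \<mu> Ts Rs rs" and ?S = "{0<..<T} \<times> ball (0::complex) R"
  have \<mu>_pos: "0 < \<mu> t" if "t \<in> {0<..T0}" for t
    using wt that by (auto simp: weight_function_def)
  define c where "c = - Re (deriv (\<lambda>u. F (0, 0, u, 0)) 0) / 2"
  have c: "0 < c" "Re (deriv (\<lambda>u. F (0, 0, u, 0)) 0) < - c" using assms(9) by (auto simp: c_def)
  obtain r C K where r: "0 < r" and C: "0 \<le> C" and K: "0 < K" and lin:
    "\<And>t x u v u' v'. \<lbrakk>0 < t; t < r; norm x < r; norm u < r; norm v < r; norm u' < r; norm v' < r\<rbrakk> \<Longrightarrow>
       \<exists>\<Lambda> B. F (t, x, u, v) - F (t, x, u', v') = \<Lambda> * (u - u') + B * (v - v') \<and>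
         Re \<Lambda> < - c \<and> norm B \<le> C * \<mu> t + K * (norm u' + norm v + norm v')"
    using linearization[OF pos assms(4,5) \<mu>_pos assms(8) c(2)] by blast
  obtain M where M: "0 < M" "\<And>t x. (t, x) \<in> ?W \<Longrightarrow> 0 < t \<Longrightarrow> norm (u0 (t, x)) \<le> M * \<mu> t \<and> norm (dx u0 t x) \<le> M * \<mu> t"
    using sol0 by (auto simp: bounded_solution_W_def)
  have X0: "X1 ?W u0" and E0: "solves_E F T0 R0 \<rho>0 ?W u0"
    using sol0 by (auto simp: bounded_solution_W_def)
  \<comment> \<open>With radius \<open>d / 2\<close> and bound
    \<open>2 * \<epsilon> * d\<^sup>2\<close> for w, the condition that starts the descent reads
    \<open>\<epsilon> * (2048 * K * ln 4) \<le> c\<close>.\<close>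
  define \<epsilon> where "\<epsilon> = min 1 (c / (2048 * K * ln 4))"
  have \<epsilon>: "0 < \<epsilon>" "\<epsilon> \<le> 1" "\<epsilon> * (2048 * K * ln 4) \<le> c"
    using c K by (auto simp: \<epsilon>_def min_def field_simps)
  define d0 where "d0 = Min {1, r / 8, R, Rs}"
  have d0: "0 < d0" "d0 \<le> 1" "d0 \<le> r / 8" "d0 \<le> R" "d0 \<le> Rs"
    using r assms(12,17) by (auto simp: d0_def)
  \<comment> \<open>The smallness of u is used at this single radius d.\<close>
  obtain d where d: "0 < d" "d < d0" and ev: "\<forall>\<^sub>F \<sigma> in at_right 0.
      \<forall>p\<in>{0<..<\<sigma>} \<times> ball 0 d. norm (u p) \<le> \<epsilon> * d\<^sup>2"
  proof -
    have "\<forall>\<^sub>F d in at_right 0. d \<in> {0<..<d0}" using d0(1) by (rule eventually_at_right_real)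
    then have "\<forall>\<^sub>F d in at_right 0. d \<in> {0<..<d0} \<and> (\<forall>\<^sub>F \<sigma> in at_right 0.
        \<forall>p\<in>{0<..<\<sigma>} \<times> ball 0 d. norm (u p) \<le> \<epsilon> * d\<^sup>2)"
      using eventually_small_of_Limsup_Lim[OF assms(20) \<epsilon>(1)] by eventually_elim simp
    then obtain d where "d \<in> {0<..<d0}" "\<forall>\<^sub>F \<sigma> in at_right 0.
        \<forall>p\<in>{0<..<\<sigma>} \<times> ball 0 d. norm (u p) \<le> \<epsilon> * d\<^sup>2"
      using eventually_happens'[OF trivial_limit_at_right_real] by blast
    then show ?thesis using that[of d] by simp
  qed
  define N where "N = \<epsilon> * d\<^sup>2"
  have N: "0 < N" using \<epsilon> d by (simp add: N_def)
  have "N \<le> 1 * (1 * d)"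
    unfolding N_def power2_eq_square using \<epsilon> d d0 by (intro mult_mono) auto
  then have Nr: "N < r" using d d0 r by simp
  \<comment> \<open>The bound for B contains u0, its x-derivative and that of u. Comparing the last
    with \<open>dx u0\<close> gives three terms of size \<open>M * \<mu> t\<close>, hence
    \<open>3 * K * M\<close>, plus a multiple of the x-derivative of w.\<close>
  define m where "m t = (C + 3 * K * M) * \<mu> t" for t
  define \<psi> where "\<psi> t = (C + 3 * K * M) * weight_phi \<mu> t" for t
  \<comment> \<open>The smallness conditions on t are collected: \<open>M * \<mu> t < N\<close>
    bounds u0 and its x-derivative, \<open>weight_phi \<mu> t / rs < Rs / 2\<close> places points in
    the domain of u0, and \<open>\<psi> t < d / 8\<close> fixes the final radius.\<close>
  have \<phi>0: "(weight_phi \<mu> \<longlongrightarrow> 0) (at_right 0)" by (rule weight_phi_tendsto_0[OF wt pos(1)])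
  have "\<forall>\<^sub>F \<sigma> in at_right 0. \<forall>p\<in>{0<..<\<sigma>} \<times> ball 0 d. norm (u p) \<le> N"
    using ev by (simp add: N_def)
  moreover have "\<forall>\<^sub>F t in at_right 0. t \<in> {0<..<Min {T, Ts, r}}"
    using assms(10,16) r by (intro eventually_at_right_real) auto
  moreover have "((\<lambda>t. M * \<mu> t) \<longlongrightarrow> M * 0) (at_right 0)"
    by (intro tendsto_intros weight_function_tendsto_0[OF wt pos(1)])
  then have "\<forall>\<^sub>F t in at_right 0. M * \<mu> t < N" by (rule order_tendstoD) (use N in simp)
  moreover have "((\<lambda>t. weight_phi \<mu> t / rs) \<longlongrightarrow> 0 / rs) (at_right 0)"
    using \<phi>0 assms(13) by (intro tendsto_intros) auto
  then have "\<forall>\<^sub>F t in at_right 0. weight_phi \<mu> t / rs < Rs / 2"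
    by (rule order_tendstoD) (use assms(12) in simp)
  moreover have "(\<psi> \<longlongrightarrow> (C + 3 * K * M) * 0) (at_right 0)"
    unfolding \<psi>_def by (intro tendsto_intros \<phi>0)
  then have "\<forall>\<^sub>F t in at_right 0. \<psi> t < d / 8" by (rule order_tendstoD) (use d in simp)
  ultimately have "\<forall>\<^sub>F t in at_right 0. (\<forall>p\<in>{0<..<t} \<times> ball 0 d. norm (u p) \<le> N) \<and>
      t \<in> {0<..<Min {T, Ts, r}} \<and> M * \<mu> t < N \<and> weight_phi \<mu> t / rs < Rs / 2 \<and> \<psi> t < d / 8"
    by eventually_elim simp
  then obtain \<sigma>' where "0 < \<sigma>'" and \<sigma>': "\<And>t. 0 < t \<Longrightarrow> t < \<sigma>' \<Longrightarrow>
      (\<forall>p\<in>{0<..<t} \<times> ball 0 d. norm (u p) \<le> N) \<and>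
      t \<in> {0<..<Min {T, Ts, r}} \<and> M * \<mu> t < N \<and> weight_phi \<mu> t / rs < Rs / 2 \<and> \<psi> t < d / 8"
    unfolding eventually_at_right_field by auto
  \<comment> \<open>The bound on u is available on \<open>{0<..<t}\<close> for
    \<open>t < \<sigma>'\<close>; halving allows \<open>t = \<sigma>\<close> there.\<close>
  define \<sigma> where "\<sigma> = \<sigma>' / 2"
  have "0 < \<sigma>" using \<open>0 < \<sigma>'\<close> by (simp add: \<sigma>_def)
  have \<sigma>: "0 < t" "t < T" "t < Ts" "t < r" "t \<in> {0<..T0}" "M * \<mu> t < N" "weight_phi \<mu> t / rs < Rs / 2" "\<psi> t < d / 8"
    if "t \<in> {0<..<\<sigma>}" for t
    using \<sigma>'[of t] that \<open>0 < \<sigma>'\<close> assms(11) by (auto simp: \<sigma>_def)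
  have u_le: "norm (u (t, x)) \<le> N" if "t \<in> {0<..<\<sigma>}" "x \<in> ball 0 d" for t x
    using \<sigma>'[of \<sigma>] that \<open>0 < \<sigma>'\<close> by (auto simp: \<sigma>_def)
  let ?U = "{0<..<\<sigma>} \<times> ball (0::complex) (d / 2)"
  have subS: "{0<..<\<sigma>} \<times> ball 0 d \<subseteq> ?S" using \<sigma> d d0 by auto
  have subS': "?U \<subseteq> ?S" using \<sigma> d d0 by fastforce
  have subW: "?U \<subseteq> ?W"
  proof
    fix p assume "p \<in> ?U"
    then obtain t x where p: "p = (t, x)" "t \<in> {0<..<\<sigma>}" "norm x < d / 2" by auto
    have "weight_phi \<mu> t / rs + norm x < Rs" using \<sigma>(7)[OF p(2)] p(3) d d0 by linarith
    then show "p \<in> ?W" using \<sigma>[OF p(2)] p(1) by (simp add: W_region_def)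
  qed
  have dxu: "norm (dx u t x) \<le> N / (d / 4)" if t: "t \<in> {0<..<\<sigma>}" and x: "x \<in> ball 0 (d / 2)" for t x
    unfolding dx_def
  proof (rule norm_deriv_le)
    show "(\<lambda>y. u (t, y)) holomorphic_on {y. (t, y) \<in> ?S}" using X unfolding X1_def by blast
    have sub: "cball x (d / 4) \<subseteq> ball 0 d" using x d by (auto simp: cball_subset_ball_iff)
    then show "cball x (d / 4) \<subseteq> {y. (t, y) \<in> ?S}" using subS t by blast
    show "norm (u (t, y)) \<le> N" if "y \<in> cball x (d / 4)" for y using u_le[OF t] sub that by blast
  qed (use d in simp)
  \<comment> \<open>Since \<open>N \<le> d\<^sup>2\<close> and \<open>d < r / 8\<close>, the
    x-derivative of u falls within the range of the linearization.\<close>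
  have "4 * N / d \<le> 4 * d"
    unfolding N_def power2_eq_square using \<epsilon> d by (simp add: field_simps)
  then have "4 * N / d < r" using d d0 by linarith
  then have Ndr: "N / (d / 4) < r" by (simp add: mult.commute)
  define w where "w p = u p - u0 p" for p
  let ?a = "\<lambda>t x. dt_within ?S u t x - dt_within ?W u0 t x" and ?b = "\<lambda>t x. dx u t x - dx u0 t x"
  \<comment> \<open>The bound \<open>2 * N\<close> for w adds N for u and
    \<open>M * \<mu> t < N\<close> for u0.\<close>
  have w0: "w (t, x) = 0" if tx: "t \<in> {0<..<\<sigma>}" "norm x + \<psi> t < d / 2 / 2" for t x
  proof (rule descent_eq_0[where K=K and M="2 * N" and \<rho>="d / 2" and \<sigma>=\<sigma> and \<psi>=\<psi> and m=m and a="?a" and b="?b" and c=c])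
    fix t assume t: "t \<in> {0<..<\<sigma>}"
    show "(\<psi> has_real_derivative m t / t) (at t)"
    proof -
      have "(weight_phi \<mu> has_real_derivative \<mu> t / t) (at t)"
        using \<sigma>[OF t] assms(11) by (intro has_real_derivative_weight_phi[OF wt]) auto
      then have "(\<psi> has_real_derivative (C + 3 * K * M) * (\<mu> t / t)) (at t)"
        unfolding \<psi>_def by (rule DERIV_cmult)
      then show ?thesis by (simp add: m_def)
    qed
    show "0 \<le> \<psi> t"
      using weight_phi_nonneg[OF wt, of t] \<sigma>[OF t] C K M by (simp add: \<psi>_def)
    fix x :: complex assume x: "x \<in> ball 0 (d / 2)"
    have inW: "(t, x) \<in> ?W" and inS: "(t, x) \<in> ?S" using subW subS' t x by blast+
    have "(w has_derivative (\<lambda>p. (case p of (\<tau>, h) \<Rightarrow> of_real \<tau> * dt_within ?S u t x + dx u t x * h)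
        - (case p of (\<tau>, h) \<Rightarrow> of_real \<tau> * dt_within ?W u0 t x + dx u0 t x * h))) (at (t, x))"
      unfolding w_def
      by (rule has_derivative_diff[OF X1_has_derivative[OF X subS' t x] X1_has_derivative[OF X0 subW t x]])
    then show "(w has_derivative (\<lambda>(\<tau>, h). of_real \<tau> * ?a t x + ?b t x * h)) (at (t, x))"
      by (rule has_derivative_eq_rhs) (auto simp: fun_eq_iff algebra_simps)
    have u0_le: "norm (u0 (t, x)) \<le> M * \<mu> t" "norm (dx u0 t x) \<le> M * \<mu> t"
      using M(2)[OF inW] \<sigma>[OF t] by auto
    show "norm (w (t, x)) \<le> 2 * N"
      using norm_triangle_ineq4[of "u (t, x)" "u0 (t, x)"] u0_le \<sigma>(6)[OF t] u_le[OF t, of x] x d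
      by (simp add: w_def)
    obtain \<Lambda> B where \<Lambda>: "F (t, x, u (t, x), dx u t x) - F (t, x, u0 (t, x), dx u0 t x) =
        \<Lambda> * (u (t, x) - u0 (t, x)) + B * (dx u t x - dx u0 t x)" "Re \<Lambda> < - c"
      and B: "norm B \<le> C * \<mu> t + K * (norm (u0 (t, x)) + norm (dx u t x) + norm (dx u0 t x))"
      using lin[of t x "u (t, x)" "dx u t x" "u0 (t, x)" "dx u0 t x"] \<sigma>[OF t] u0_le u_le[OF t, of x] dxu[OF t x]
        Nr Ndr x d d0 by auto
    have "norm (dx u t x) \<le> norm (dx u0 t x) + norm (?b t x)"
      using norm_triangle_sub[of "dx u t x" "dx u0 t x"] by simp
    then have "K * (norm (u0 (t, x)) + norm (dx u t x) + norm (dx u0 t x)) \<le>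
        K * (3 * (M * \<mu> t) + norm (?b t x))"
      using u0_le K by (intro mult_left_mono) auto
    with B have "norm B \<le> m t + K * norm (?b t x)"
      by (simp add: m_def algebra_simps)
    moreover have "of_real t * ?a t x = \<Lambda> * w (t, x) + B * ?b t x"
    proof -
      have "of_real t * dt_within ?S u t x = F (t, x, u (t, x), dx u t x)"
        using sol inS \<sigma>(1)[OF t] unfolding solves_E_def by blast
      moreover have "of_real t * dt_within ?W u0 t x = F (t, x, u0 (t, x), dx u0 t x)"
        using E0 inW \<sigma>(1)[OF t] unfolding solves_E_def by blast
      ultimately show ?thesis using \<Lambda>(1) by (simp add: w_def right_diff_distrib)
    qed
    ultimately show "\<exists>\<Lambda> B. of_real t * ?a t x = \<Lambda> * w (t, x) + B * ?b t x \<and> Re \<Lambda> < - c \<and>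
        norm B \<le> m t + K * norm (?b t x)"
      using \<Lambda>(2) by blast
  next
    have "c * ((d / 2 / 8)\<^sup>2 / (4 * K * (2 * N))) = c / (2048 * K * \<epsilon>)"
      using d K \<epsilon>(1) by (simp add: N_def power2_eq_square)
    moreover have "ln 4 \<le> c / (2048 * K * \<epsilon>)"
      using \<epsilon> K by (simp add: pos_le_divide_eq mult_ac)
    ultimately show "ln 4 \<le> c * ((d / 2 / 8)\<^sup>2 / (4 * K * (2 * N)))" by simp
  qed (use tx K N d in auto)
  show ?thesis
  proof (intro exI conjI)
    show "0 < \<sigma>" "0 < d / 8" using \<open>0 < \<sigma>\<close> d by auto
    \<comment> \<open>With \<open>\<psi> t < d / 8\<close>, points with
      \<open>norm x < d / 8\<close> satisfy \<open>norm x + \<psi> t < d / 4\<close>, the region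
      where w vanishes.\<close>
    have "{0<..<\<sigma>} \<times> ball 0 (d / 8) \<subseteq> ?U" using d by auto
    then show "{0<..<\<sigma>} \<times> ball 0 (d / 8) \<subseteq> ?S \<inter> ?W" using subS' subW by blast
    show "\<forall>p\<in>{0<..<\<sigma>} \<times> ball 0 (d / 8). u p = u0 p"
    proof
      fix p assume "p \<in> {0<..<\<sigma>} \<times> ball (0::complex) (d / 8)"
      then obtain t x where p: "p = (t, x)" "t \<in> {0<..<\<sigma>}" "norm x < d / 8" by auto
      then show "u p = u0 p" using w0[of t x] \<sigma>(8)[OF p(2)] by (simp add: w_def)
    qed
  qed
qed

end
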